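(* There exist $r_0>0$ and $K>0$ such that the following holds for all $r=r(n)\le r_0$: if $q=\pi r^2 p \ge K\log n / n$, then with probability tending to $1$ as $n\to\infty$, $G(n,r,p)$ is Hamiltonian.
   Context: The random graph $G(n,r,p)$ is defined as follows. Place $n$ points independently and uniformly at random in the unit torus $[0,1]^2$ (opposite sides identified), and join two points by an edge if their distance in the torus metric is at most $r$; this is the random geometric graph $G(n,r)$. Independently, let $G(n,p)$ be the Erdős–Rényi random graph on the same $n$ vertices, where each pair is an edge independently with probability $p=p(n)$. Then $G(n,r,p)=G(n,r)\cap G(n,p)$. Logarithms are natural. *)

theory Defs
  imports "HOL-Probability.Probability"
begin

definition hamiltonian :: "'a set \<Rightarrow> 'a set set \<Rightarrow> bool" where
  "hamiltonian V E \<longleftrightarrow>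
     (\<exists>vs. distinct vs \<and> set vs = V \<and> length vs \<ge> 3 \<and>
           (\<forall>i<length vs. {vs ! i, vs ! (Suc i mod length vs)} \<in> E))"

(* The quotient metric of (R x R) / (Z x Z), on representatives. *)
definition torus_dist :: "real \<times> real \<Rightarrow> real \<times> real \<Rightarrow> real" where
  "torus_dist x y = (INF k\<in>\<int> \<times> \<int>. dist x (y + k))"

definition uniform_torus :: "(real \<times> real) measure" where
  "uniform_torus = uniform_measure lborel ({0..1} \<times> {0..1})"

definition vertex_pairs :: "nat \<Rightarrow> nat set set" where
  "vertex_pairs n = {e. e \<subseteq> {..<n} \<and> card e = 2}"

(* All graphs have vertex set {..<n}, so a graph is given by its set of edges. *)
definition geometric_graph :: "nat \<Rightarrow> real \<Rightarrow> (nat \<Rightarrow> real \<times> real) \<Rightarrow> nat set set" where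
  "geometric_graph n r X =
     {{i, j} | i j. i < n \<and> j < n \<and> i \<noteq> j \<and> torus_dist (X i) (X j) \<le> r}"

definition erdos_renyi :: "nat \<Rightarrow> real \<Rightarrow> nat set set pmf" where
  "erdos_renyi n p =
     map_pmf Collect (Pi_pmf (vertex_pairs n) False (\<lambda>_. bernoulli_pmf p))"

(* A sample (X, F) consists of the positions X of the n vertices and, independently,
   the edge set F of G(n,p); the graph G(n,r,p) is geometric_graph n r X \<inter> F. *)
definition sample_space :: "nat \<Rightarrow> real \<Rightarrow> ((nat \<Rightarrow> real \<times> real) \<times> nat set set) measure" where
  "sample_space n p =
     (\<Pi>\<^sub>M i\<in>{..<n}. uniform_torus) \<Otimes>\<^sub>M measure_pmf (erdos_renyi n p)"

end

theory Submission
  imports Defs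
begin

text \<open>Cut the torus into \<open>k\<^sup>2\<close> square cells of side between \<open>r / 5\<close> and \<open>r / 4\<close>, numbered cyclically
  so that points in equal or consecutive cells have distance at most \<open>r\<close>. By a Chernoff bound every
  cell receives so many points that, inside a cell with \<open>m\<close> points, \<open>G(n,p)\<close> has average degree
  \<open>p m \<ge> 1000 log n\<close>; it is then an expander, and two large subsets of consecutive cells are always
  joined by an edge. By Posa's rotations a longest path starting at a given vertex has more than
  \<open>m / 10\<close> possible endpoints. Hence a vertex missed by a longest path would have no neighbour in a
  large set that does not depend on the edges at that vertex, which is unlikely; so each cell has a
  Hamiltonian path, with many choices for both ends. Linking the cells one after another gives
  Hamiltonian paths whose two ends range over many pairs in the first and the last cell, and one of
  the so far unexposed edges between these two cells closes a cycle.\<close>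

section \<open>Path rotations\<close>

text \<open>The obstacle is that endpoint sets depend on the very edges that are to meet them. Two
  devices avoid this. \<open>expander\<close> and \<open>joined\<close> quantify over all vertex
  sets, so they may be applied to sets that depend on the graph; the price is a union bound over
  many sets, which the density of a cell can pay. Where no such bound is at hand, the useful pairs
  are determined by the remaining edges, so one random graph suffices and no second one has to be
  sprinkled in. This second device is needed at the closing step because the possible ends of a
  Hamiltonian path depend on its start: they form a set of pairs, not a product of two sets as in
  \<open>joined\<close>. The threshold \<open>200000\<close> is \<open>1000 * 2 * 100\<close>:
  density \<open>1000\<close> in each cell, a factor 2 because a cell is only known to receive half
  of its expected points, and \<open>pi * r^2 <= 4 * 25 / k^2\<close>. The bound
  \<open>r <= 1\<close> ensures that rounding \<open>4 / r\<close> up to an integer \<open>k\<close>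
  costs at most a factor \<open>5 / 4\<close>.\<close>

fun path_edges :: "'a list \<Rightarrow> 'a set set" where
  "path_edges (x # y # xs) = insert {x, y} (path_edges (y # xs))"
| "path_edges _ = {}"

definition is_path :: "'a set set \<Rightarrow> 'a list \<Rightarrow> bool" where
  "is_path E xs \<longleftrightarrow> xs \<noteq> [] \<and> distinct xs \<and> path_edges xs \<subseteq> E"

lemma path_edges_append:
  "path_edges (xs @ ys) = path_edges xs \<union> path_edges ys \<union>
     (if xs = [] \<or> ys = [] then {} else {{last xs, hd ys}})"
proof (induction xs rule: path_edges.induct)
  case (1 x y xs)
  then show ?case by auto
next
  case "2_1"
  then show ?case by simp
next
  case ("2_2" x)
  then show ?case by (cases ys) auto
qed

lemma path_edges_Cons:
  "path_edges (x # xs) = path_edges xs \<union> (if xs = [] then {} else {{x, hd xs}})"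
  by (cases xs) auto

lemma path_edges_rev [simp]: "path_edges (rev xs) = path_edges xs"
  by (induction xs) (auto simp: path_edges_append path_edges_Cons last_rev insert_commute)

lemma path_edges_subset: "e \<in> path_edges xs \<Longrightarrow> e \<subseteq> set xs"
  by (induction xs rule: path_edges.induct) auto

lemma card_path_nbrs_le:
  assumes "distinct xs"
  shows "card {y. {x, y} \<in> path_edges xs} \<le> 2"
proof (cases "x \<in> set xs")
  case False
  then have "{y. {x, y} \<in> path_edges xs} = {}"
    using path_edges_subset by fastforce
  then show ?thesis by simp
next
  case True
  then obtain A B where xs: "xs = A @ x # B"
    by (meson split_list)
  then have "x \<notin> set A" "x \<notin> set B" using assms by auto
  then have "{y. {x, y} \<in> path_edges xs} \<subseteq> {last A, hd B}"
    using path_edges_subset[of _ A] path_edges_subset[of _ B]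
    by (auto simp: xs path_edges_append path_edges_Cons doubleton_eq_iff split: if_splits)
  then have "card {y. {x, y} \<in> path_edges xs} \<le> card {last A, hd B}"
    by (intro card_mono) auto
  also have "\<dots> \<le> 2" by (simp add: card_insert_if)
  finally show ?thesis .
qed

inductive rotation :: "'a set set \<Rightarrow> 'a list \<Rightarrow> 'a list \<Rightarrow> bool" for E P where
  base: "rotation E P P"
| step: "rotation E P (A @ x # y # B) \<Longrightarrow> {last (y # B), x} \<in> E \<Longrightarrow>
           rotation E P (A @ x # rev (y # B))"

lemma rotation_is_path:
  assumes "rotation E P Q" "is_path E P"
  shows "is_path E Q \<and> set Q = set P \<and> hd Q = hd P"
  using assms
proof (induction)
  case (step A x y B)
  let ?Q = "A @ x # y # B" and ?Q' = "A @ x # rev (y # B)"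
  have IH: "is_path E ?Q" "set ?Q = set P" "hd ?Q = hd P" using step by auto
  have "path_edges ?Q' \<subseteq> insert {x, last (y # B)} (path_edges ?Q)"
    using path_edges_rev[of "y # B"]
    by (auto simp: path_edges_append path_edges_Cons hd_rev hd_append split: if_splits)
  then have "path_edges ?Q' \<subseteq> E"
    using IH(1) step.hyps(2) by (auto simp: is_path_def insert_commute)
  moreover have "distinct ?Q'" "?Q' \<noteq> []" using IH(1) by (auto simp: is_path_def)
  moreover have "set ?Q' = set P" using IH(2) by auto
  moreover have "hd ?Q' = hd P" using IH(3) by (auto simp: hd_append)
  ultimately show ?case by (auto simp: is_path_def)
qed auto

context
  fixes E :: "'a set set" and P :: "'a list" and U N :: "'a set"
  defines "U \<equiv> {last Q |Q. rotation E P Q}"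
  defines "N \<equiv> {y. \<exists>u\<in>U. {u, y} \<in> path_edges P}"
begin

text \<open>A rotation changes the path neighbours of \<open>x\<close>, \<open>y\<close> and the old
  end only. The old end and \<open>y\<close> lie in \<open>U\<close>. If \<open>z = x\<close> had
  kept its neighbours so far, \<open>{x, y}\<close> would be an edge of \<open>P\<close> itself, and
  \<open>y\<close> in \<open>U\<close> would put \<open>x\<close> into \<open>N\<close>.\<close>

lemma rotation_keeps_nbrs:
  assumes "rotation E P Q" "z \<notin> U" "z \<notin> N"
  shows "{z, w} \<in> path_edges Q \<longleftrightarrow> {z, w} \<in> path_edges P"
  using assms(1)
proof (induction arbitrary: w)
  case (step A x y B)
  let ?Q = "A @ x # y # B" and ?Q' = "A @ x # rev (y # B)"
  have "rotation E P ?Q'" using step.hyps by (rule rotation.step)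
  moreover have "last ?Q' = y" "last ?Q = last (y # B)" by auto
  ultimately have y: "y \<in> U" and u: "last (y # B) \<in> U"
    using step.hyps(1) unfolding U_def by (metis (mono_tags, lifting) mem_Collect_eq)+
  have pQ: "path_edges ?Q = path_edges A \<union> path_edges (y # B) \<union> {{x, y}} \<union>
              (if A = [] then {} else {{last A, x}})"
    by (auto simp: path_edges_append path_edges_Cons)
  have pQ': "path_edges ?Q' = path_edges A \<union> path_edges (y # B) \<union> {{x, last (y # B)}} \<union>
              (if A = [] then {} else {{last A, x}})"
    using path_edges_rev[of "y # B"] hd_rev[of "y # B"]
    by (simp add: path_edges_append path_edges_Cons[of x] del: path_edges_rev rev.simps)
  have "z \<noteq> x"
  proof
    assume "z = x"
    then have "{z, y} \<in> path_edges P" using step.IH[of y] pQ by auto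
    then have "z \<in> N" using y unfolding N_def by (auto simp: insert_commute)
    with assms(3) show False by simp
  qed
  then have "{z, w} \<in> path_edges ?Q \<longleftrightarrow> {z, w} \<in> path_edges ?Q'"
    using y u assms(2) unfolding pQ pQ' by (auto simp: doubleton_eq_iff)
  then show ?case using step.IH by simp
qed simp

text \<open>Rotating at \<open>x\<close> turns its successor \<open>y\<close> on \<open>Q\<close>
  into an end. If \<open>x\<close> were outside \<open>N\<close>, its edge to \<open>y\<close> would
  still be an edge of \<open>P\<close>, so \<open>x\<close> would be a \<open>P\<close>-neighbour of
  a member of \<open>U\<close> after all.\<close>

lemma posa_rotation:
  assumes P: "is_path E P" and u: "u \<in> U" and x: "x \<in> set P" "x \<notin> U" "{u, x} \<in> E"
  shows "x \<in> N"
proof (rule ccontr)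
  assume nN: "x \<notin> N"
  from u obtain Q where Q: "rotation E P Q" "u = last Q" unfolding U_def by auto
  have "x \<in> set Q" using rotation_is_path[OF Q(1) P] x(1) by simp
  then obtain A C where AC: "Q = A @ x # C" by (meson split_list)
  with Q u x(2) have "C \<noteq> []" by auto
  then obtain y B where yB: "Q = A @ x # y # B" using AC by (cases C) auto
  have "rotation E P (A @ x # rev (y # B))"
    using Q x(3) unfolding yB by (intro rotation.step) auto
  moreover have "last (A @ x # rev (y # B)) = y" by simp
  ultimately have "y \<in> U" unfolding U_def by (metis (mono_tags, lifting) mem_Collect_eq)
  moreover have "{x, y} \<in> path_edges Q"
    by (auto simp: yB path_edges_append path_edges_Cons)
  then have "{y, x} \<in> path_edges P"
    using rotation_keeps_nbrs[OF Q(1) x(2) nN, of y] by (simp add: insert_commute)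
  ultimately show False using nN unfolding N_def by auto
qed

lemma posa_rotation_card:
  assumes "is_path E P"
  shows "card {x \<in> set P. x \<notin> U \<and> (\<exists>u\<in>U. {u, x} \<in> E)} \<le> 2 * card U"
proof -
  have sub: "U \<subseteq> set P"
  proof
    fix u assume "u \<in> U"
    then obtain Q where "rotation E P Q" "u = last Q" unfolding U_def by auto
    with rotation_is_path[OF _ assms] show "u \<in> set P"
      by (metis is_path_def last_in_set)
  qed
  then have fin: "finite U" by (rule finite_subset) simp
  have "card {x \<in> set P. x \<notin> U \<and> (\<exists>u\<in>U. {u, x} \<in> E)} \<le>
          card (\<Union>u\<in>U. {y. {u, y} \<in> path_edges P})"
  proof (rule card_mono)
    have "{y. {u, y} \<in> path_edges P} \<subseteq> set P" for u using path_edges_subset by fastforce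
    then show "finite (\<Union>u\<in>U. {y. {u, y} \<in> path_edges P})"
      using fin by (auto intro: finite_subset)
    show "{x \<in> set P. x \<notin> U \<and> (\<exists>u\<in>U. {u, x} \<in> E)} \<subseteq> (\<Union>u\<in>U. {y. {u, y} \<in> path_edges P})"
      using posa_rotation[OF assms] unfolding N_def by auto
  qed
  also have "\<dots> \<le> (\<Sum>u\<in>U. card {y. {u, y} \<in> path_edges P})"
    using fin by (rule card_UN_le)
  also have "\<dots> \<le> (\<Sum>u\<in>U. 2)"
    using assms by (intro sum_mono card_path_nbrs_le) (auto simp: is_path_def)
  finally show ?thesis by simp
qed

end

definition nbhd :: "'a set set \<Rightarrow> 'a set \<Rightarrow> 'a set \<Rightarrow> 'a set" where
  "nbhd E V S = {y \<in> V. y \<notin> S \<and> (\<exists>x\<in>S. {x, y} \<in> E)}"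

text \<open>By maximality all neighbours of rotation endpoints lie on the path, where at most
  \<open>2 * card U\<close> of them are outside \<open>U\<close>. So \<open>U\<close> fails to
  expand and must have more than \<open>k\<close> elements.\<close>

lemma many_endpoints:
  assumes P: "is_path E P" and sub: "set P \<subseteq> V" and fin: "finite V"
    and expand: "\<And>S. S \<subseteq> V \<Longrightarrow> S \<noteq> {} \<Longrightarrow> card S \<le> k \<Longrightarrow> 2 * card S < card (nbhd E V S)"
    and maximal: "\<And>Q y. is_path E Q \<Longrightarrow> set Q = set P \<Longrightarrow> y \<in> V \<Longrightarrow> {last Q, y} \<in> E \<Longrightarrow> y \<in> set P"
  shows "k < card {last Q |Q. is_path E Q \<and> set Q = set P \<and> hd Q = hd P}" (is "_ < card ?T")
proof -
  define U where "U = {last Q |Q. rotation E P Q}"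
  have UT: "U \<subseteq> ?T" using rotation_is_path[OF _ P] unfolding U_def by blast
  have TP: "?T \<subseteq> set P" unfolding is_path_def using last_in_set by blast
  have "last P \<in> U" unfolding U_def using rotation.base by blast
  moreover have "nbhd E V U \<subseteq> {x \<in> set P. x \<notin> U \<and> (\<exists>u\<in>U. {u, x} \<in> E)}"
    using UT maximal unfolding nbhd_def by blast
  then have "card (nbhd E V U) \<le> 2 * card U"
    using posa_rotation_card[OF P] card_mono[of "{x \<in> set P. x \<notin> U \<and> (\<exists>u\<in>U. {u, x} \<in> E)}" "nbhd E V U"]
    unfolding U_def by fastforce
  ultimately have "k < card U" using expand[of U] UT TP sub by force
  also have "\<dots> \<le> card ?T" using UT TP by (intro card_mono) (auto intro: finite_subset)
  finally show ?thesis .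
qed

section \<open>Hamiltonian paths in expanders\<close>

definition ham_ends :: "'a set set \<Rightarrow> 'a set \<Rightarrow> 'a \<Rightarrow> 'a set" where
  "ham_ends E W s = {last P |P. is_path E P \<and> set P = W \<and> hd P = s}"

definition longest_ends :: "'a set set \<Rightarrow> 'a set \<Rightarrow> 'a set" where
  "longest_ends E W = {last P |P. is_path E P \<and> set P \<subseteq> W \<and>
     (\<forall>Q. is_path E Q \<and> set Q \<subseteq> W \<longrightarrow> length Q \<le> length P)}"

text \<open>Posa's argument needs expansion by more than 2. The factor 4 leaves room for deleting
  one vertex from \<open>V\<close>: for \<open>s >= 1\<close> still
  \<open>4 * s - 1 > 2 * s\<close>.\<close>

definition expander :: "'a set set \<Rightarrow> 'a set \<Rightarrow> nat \<Rightarrow> bool" where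
  "expander E V k \<longleftrightarrow>
     (\<forall>S. S \<subseteq> V \<and> S \<noteq> {} \<and> card S \<le> k \<longrightarrow> 4 * card S \<le> card (nbhd E V S))"

text \<open>The strict thresholds match the bounds \<open>k < card (ham_ends ...)\<close>. Being
  uniform in \<open>S\<close> and \<open>T\<close>, the property applies to endpoint sets computed
  from \<open>E\<close> itself.\<close>

definition joined :: "'a set set \<Rightarrow> 'a set \<Rightarrow> nat \<Rightarrow> 'a set \<Rightarrow> nat \<Rightarrow> bool" where
  "joined E V k W l \<longleftrightarrow>
     (\<forall>S T. S \<subseteq> V \<and> T \<subseteq> W \<and> k < card S \<and> l < card T \<longrightarrow> (\<exists>x\<in>S. \<exists>y\<in>T. {x, y} \<in> E))"

lemma is_path_snoc:
  "is_path E P \<Longrightarrow> y \<notin> set P \<Longrightarrow> {last P, y} \<in> E \<Longrightarrow> is_path E (P @ [y])"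
  by (auto simp: is_path_def path_edges_append)

lemma is_path_append:
  "is_path E P \<Longrightarrow> is_path E Q \<Longrightarrow> set P \<inter> set Q = {} \<Longrightarrow> {last P, hd Q} \<in> E \<Longrightarrow> is_path E (P @ Q)"
  by (auto simp: is_path_def path_edges_append)

lemma length_is_path: "is_path E P \<Longrightarrow> length P = card (set P)"
  by (auto simp: is_path_def distinct_card)

lemma is_path_cong:
  assumes "\<And>e. e \<subseteq> set P \<Longrightarrow> e \<in> E \<longleftrightarrow> e \<in> E'"
  shows "is_path E P \<longleftrightarrow> is_path E' P"
  using assms path_edges_subset[of _ P] unfolding is_path_def by blast

text \<open>This is the source of independence: for \<open>W = V - {v}\<close> the set is a function
  of the edges avoiding \<open>v\<close>.\<close>

lemma longest_ends_cong:
  assumes "\<And>e. e \<subseteq> W \<Longrightarrow> e \<in> E \<longleftrightarrow> e \<in> E'"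
  shows "longest_ends E W = longest_ends E' W"
proof -
  have "is_path E P \<longleftrightarrow> is_path E' P" if "set P \<subseteq> W" for P
    using that assms by (intro is_path_cong) auto
  then show ?thesis unfolding longest_ends_def by blast
qed

lemma longest_ends_subset: "longest_ends E W \<subseteq> W"
  unfolding longest_ends_def is_path_def by auto

lemma ham_ends_subset: "ham_ends E W s \<subseteq> W"
  unfolding ham_ends_def is_path_def by auto

lemma last_in_ham_ends: "is_path E P \<Longrightarrow> set P = W \<Longrightarrow> last P \<in> ham_ends E W (hd P)"
  unfolding ham_ends_def by blast

lemma ham_ends_sym: "t \<in> ham_ends E W s \<longleftrightarrow> s \<in> ham_ends E W t"
proof -
  have "s \<in> ham_ends E W t" if "t \<in> ham_ends E W s" for s t
  proof -
    from that obtain P where P: "is_path E P" "set P = W" "hd P = s" "last P = t"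
      unfolding ham_ends_def by auto
    then have "is_path E (rev P)" "set (rev P) = W" "hd (rev P) = t" "last (rev P) = s"
      by (auto simp: is_path_def hd_rev last_rev)
    then show ?thesis unfolding ham_ends_def by blast
  qed
  then show ?thesis by blast
qed

text \<open>A longest path misses a vertex \<open>v\<close> only if it is also longest in \<open>V - {v}\<close>; then
  \<open>v\<close> has no neighbour among the many endpoints of such paths.\<close>

lemma ham_path_exists:
  assumes fin: "finite V" and ne: "V \<noteq> {}" and exp: "expander E V k"
    and hit: "\<And>v. v \<in> V \<Longrightarrow> k < card (longest_ends E (V - {v})) \<Longrightarrow>
                \<exists>t \<in> longest_ends E (V - {v}). {v, t} \<in> E"
  shows "\<exists>P. is_path E P \<and> set P = V"
proof -
  let ?paths = "{P. is_path E P \<and> set P \<subseteq> V}"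
  obtain v0 where v0: "v0 \<in> V" using ne by auto
  then have "is_path E [v0] \<and> set [v0] \<subseteq> V" by (simp add: is_path_def)
  moreover have "\<forall>P. is_path E P \<and> set P \<subseteq> V \<longrightarrow> length P < Suc (card V)"
    using length_is_path card_mono[OF fin] by (metis less_Suc_eq_le)
  ultimately obtain P where P: "is_path E P" "set P \<subseteq> V"
    and longest: "\<And>Q. is_path E Q \<Longrightarrow> set Q \<subseteq> V \<Longrightarrow> length Q \<le> length P"
    using ex_has_greatest_nat[of "\<lambda>P. is_path E P \<and> set P \<subseteq> V" "[v0]" length "Suc (card V)"] by blast
  show ?thesis
  proof (rule ccontr)
    assume "\<not> ?thesis"
    then obtain v where v: "v \<in> V" "v \<notin> set P" using P by blast
    let ?T = "longest_ends E (V - {v})"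
    have "k < card {last Q |Q. is_path E Q \<and> set Q = set P \<and> hd Q = hd P}" (is "_ < card ?T'")
    proof (rule many_endpoints[OF P(1), of "V - {v}"])
      show "set P \<subseteq> V - {v}" "finite (V - {v})" using P v fin by auto
    next
      fix S assume S: "S \<subseteq> V - {v}" "S \<noteq> {}" "card S \<le> k"
      have "4 * card S \<le> card (nbhd E V S)" using exp S unfolding expander_def by auto
      also have "nbhd E V S \<subseteq> insert v (nbhd E (V - {v}) S)" by (auto simp: nbhd_def)
      then have "card (nbhd E V S) \<le> card (insert v (nbhd E (V - {v}) S))"
        using fin by (intro card_mono) (auto simp: nbhd_def)
      also have "\<dots> \<le> Suc (card (nbhd E (V - {v}) S))" by (rule card_insert_le_m1) auto
      finally have "4 * card S \<le> Suc (card (nbhd E (V - {v}) S))" .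
      moreover have "card S > 0" using S fin by (meson card_gt_0_iff finite_Diff finite_subset)
      ultimately show "2 * card S < card (nbhd E (V - {v}) S)" by linarith
    next
      fix Q y assume Q: "is_path E Q" "set Q = set P" "y \<in> V - {v}" "{last Q, y} \<in> E"
      show "y \<in> set P"
      proof (rule ccontr)
        assume "y \<notin> set P"
        then have "is_path E (Q @ [y])" using Q by (intro is_path_snoc) auto
        then have "length (Q @ [y]) \<le> length P"
          using longest[of "Q @ [y]"] Q P by auto
        moreover have "length Q = length P" using length_is_path[OF Q(1)] length_is_path[OF P(1)] Q(2) by simp
        ultimately show False by simp
      qed
    qed
    also have "?T' \<subseteq> ?T"
    proof
      fix t assume "t \<in> ?T'"
      then obtain Q where Q: "t = last Q" "is_path E Q" "set Q = set P" by auto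
      then have "length Q = length P" using length_is_path[OF Q(2)] length_is_path[OF P(1)] by simp
      then show "t \<in> ?T" using Q longest P v unfolding longest_ends_def
        by (intro CollectI exI[of _ Q]) auto
    qed
    then have "card ?T' \<le> card ?T"
      using fin longest_ends_subset[of E "V - {v}"] by (intro card_mono) (auto intro: finite_subset)
    finally obtain t where t: "t \<in> ?T" "{v, t} \<in> E" using hit v by blast
    then obtain Q where Q: "t = last Q" "is_path E Q" "set Q \<subseteq> V - {v}" "length P \<le> length Q"
      using P v unfolding longest_ends_def by blast
    then have "is_path E (Q @ [v])" using t by (intro is_path_snoc) (auto simp: insert_commute)
    then have "length (Q @ [v]) \<le> length P" using longest[of "Q @ [v]"] Q v by auto
    then show False using Q by simp
  qed
qed

text \<open>A path through all of \<open>V\<close> has no vertex of \<open>V\<close> left to be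
  extended to, so maximality is automatic and one Hamiltonian path starting at \<open>s\<close>
  produces many ends.\<close>

lemma card_ham_ends:
  assumes fin: "finite V" and exp: "expander E V k" and t: "t \<in> ham_ends E V s"
  shows "k < card (ham_ends E V s)"
proof -
  obtain P where P: "is_path E P" "set P = V" "hd P = s"
    using t unfolding ham_ends_def by auto
  have "k < card {last Q |Q. is_path E Q \<and> set Q = set P \<and> hd Q = hd P}"
  proof (rule many_endpoints[OF P(1), of V])
    fix S assume S: "S \<subseteq> V" "S \<noteq> {}" "card S \<le> k"
    then have "4 * card S \<le> card (nbhd E V S)" using exp unfolding expander_def by auto
    moreover have "card S > 0" using S fin by (meson card_gt_0_iff finite_subset)
    ultimately show "2 * card S < card (nbhd E V S)" by linarith
  qed (use P fin in auto)
  then show ?thesis using P by (simp add: ham_ends_def)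
qed

text \<open>A single linking edge per step is enough: entering the next cell at \<open>y\<close>
  fixes one start, and rotations inside that cell restore more than \<open>k (Suc j)\<close>
  ends.\<close>

lemma chain_ham_ends:
  fixes V :: "nat \<Rightarrow> 'a set"
  assumes fin: "\<And>i. i < N \<Longrightarrow> finite (V i)"
    and disj: "\<And>i j. i < N \<Longrightarrow> j < N \<Longrightarrow> i \<noteq> j \<Longrightarrow> V i \<inter> V j = {}"
    and ex: "\<And>i. i < N \<Longrightarrow> \<exists>P. is_path E P \<and> set P = V i"
    and exp: "\<And>i. i < N \<Longrightarrow> expander E (V i) (k i)"
    and join: "\<And>i. Suc i < N \<Longrightarrow> joined E (V i) (k i) (V (Suc i)) (k (Suc i))"
    and s: "t \<in> ham_ends E (V 0) s"
  shows "j < N \<Longrightarrow> k j < card (ham_ends E (\<Union>i\<le>j. V i) s \<inter> V j)"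
proof (induction j)
  case 0
  then show ?case
    using card_ham_ends[OF fin exp s] ham_ends_subset[of E "V 0" s] by (simp add: Int_absorb2)
next
  case (Suc j)
  let ?A = "ham_ends E (\<Union>i\<le>j. V i) s \<inter> V j"
  obtain P where P: "is_path E P" "set P = V (Suc j)" using ex Suc.prems by blast
  define S where "S = ham_ends E (V (Suc j)) (hd P)"
  have S: "k (Suc j) < card S" "S \<subseteq> V (Suc j)"
    using card_ham_ends[OF fin[OF Suc.prems] exp[OF Suc.prems] last_in_ham_ends[OF P]]
    unfolding S_def by (simp_all add: ham_ends_subset)
  have "k j < card ?A" "?A \<subseteq> V j" using Suc by auto
  then obtain x y where xy: "x \<in> ?A" "y \<in> S" "{x, y} \<in> E"
    using S join[OF Suc.prems] unfolding joined_def by blast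
  \<comment> \<open>The vertex \<open>y\<close> was found as an end of a Hamiltonian path of the new
    cell; reversing that path makes \<open>y\<close> a start.\<close>
  have "hd P \<in> ham_ends E (V (Suc j)) y" using xy(2) ham_ends_sym unfolding S_def by metis
  then have "k (Suc j) < card (ham_ends E (V (Suc j)) y)"
    using fin exp Suc.prems by (intro card_ham_ends) auto
  also have "\<dots> \<le> card (ham_ends E (\<Union>i\<le>Suc j. V i) s \<inter> V (Suc j))"
  proof (rule card_mono)
    show "finite (ham_ends E (\<Union>i\<le>Suc j. V i) s \<inter> V (Suc j))" using fin Suc.prems by auto
    show "ham_ends E (V (Suc j)) y \<subseteq> ham_ends E (\<Union>i\<le>Suc j. V i) s \<inter> V (Suc j)"
    proof
      fix z assume z: "z \<in> ham_ends E (V (Suc j)) y"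
      obtain Q where Q: "is_path E Q" "set Q = V (Suc j)" "hd Q = y" "last Q = z"
        using z unfolding ham_ends_def by auto
      obtain Q0 where Q0: "is_path E Q0" "set Q0 = (\<Union>i\<le>j. V i)" "hd Q0 = s" "last Q0 = x"
        using xy(1) unfolding ham_ends_def by auto
      have "V i \<inter> V (Suc j) = {}" if "i \<le> j" for i
        using that Suc.prems by (intro disj) auto
      then have "set Q0 \<inter> set Q = {}" unfolding Q(2) Q0(2) by blast
      then have path: "is_path E (Q0 @ Q)" using Q Q0 xy by (intro is_path_append) auto
      have "Q0 \<noteq> []" "Q \<noteq> []" using Q Q0 by (auto simp: is_path_def)
      then have "hd (Q0 @ Q) = s" "last (Q0 @ Q) = z" using Q Q0 by auto
      moreover have "set (Q0 @ Q) = (\<Union>i\<le>Suc j. V i)"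
        using Q Q0 by (auto simp: atMost_Suc)
      ultimately have "z \<in> ham_ends E (\<Union>i\<le>Suc j. V i) s"
        using path unfolding ham_ends_def by blast
      then show "z \<in> ham_ends E (\<Union>i\<le>Suc j. V i) s \<inter> V (Suc j)"
        using z ham_ends_subset by fastforce
    qed
  qed
  finally show ?case .
qed

text \<open>Pairs are recorded rather than two sets of ends, since the possible \<open>t\<close>
  vary with \<open>s\<close>.\<close>

definition end_pairs :: "'a set set \<Rightarrow> (nat \<Rightarrow> 'a set) \<Rightarrow> nat \<Rightarrow> ('a \<times> 'a) set" where
  "end_pairs E V j = {(s, t). s \<in> V 0 \<and> t \<in> V j \<and> t \<in> ham_ends E (\<Union>i\<le>j. V i) s}"

text \<open>One Hamiltonian path of \<open>V 0\<close> has more than \<open>k 0\<close> ends when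
  its head is fixed. By reversal each of these can start the chain, and each start reaches more than
  \<open>k j\<close> ends in \<open>V j\<close>.\<close>

lemma card_end_pairs:
  fixes V :: "nat \<Rightarrow> 'a set"
  assumes fin: "\<And>i. i < N \<Longrightarrow> finite (V i)"
    and disj: "\<And>i j. i < N \<Longrightarrow> j < N \<Longrightarrow> i \<noteq> j \<Longrightarrow> V i \<inter> V j = {}"
    and ex: "\<And>i. i < N \<Longrightarrow> \<exists>P. is_path E P \<and> set P = V i"
    and exp: "\<And>i. i < N \<Longrightarrow> expander E (V i) (k i)"
    and join: "\<And>i. Suc i < N \<Longrightarrow> joined E (V i) (k i) (V (Suc i)) (k (Suc i))"
    and j: "j < N"
  shows "Suc (k 0) * Suc (k j) \<le> card (end_pairs E V j)"
proof -
  have N: "0 < N" using j by simp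
  obtain P where P: "is_path E P" "set P = V 0" using ex N by blast
  define S where "S = ham_ends E (V 0) (hd P)"
  have S: "k 0 < card S" "S \<subseteq> V 0"
    using card_ham_ends[OF fin[OF N] exp[OF N] last_in_ham_ends[OF P]]
    unfolding S_def by (simp_all add: ham_ends_subset)
  have finS: "finite S" using S fin N finite_subset by blast
  let ?B = "\<lambda>s. ham_ends E (\<Union>i\<le>j. V i) s \<inter> V j"
  have "Suc (k 0) * Suc (k j) \<le> card S * Suc (k j)" using S by (intro mult_right_mono) auto
  also have "\<dots> = (\<Sum>s\<in>S. Suc (k j))" by simp
  also have "\<dots> \<le> (\<Sum>s\<in>S. card (?B s))"
  proof (rule sum_mono)
    fix s assume "s \<in> S"
    then have "hd P \<in> ham_ends E (V 0) s" using ham_ends_sym unfolding S_def by metis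
    from chain_ham_ends[where N = N and V = V and k = k, OF fin disj ex exp join this j]
    show "Suc (k j) \<le> card (?B s)" by (simp add: Suc_le_eq)
  qed
  also have "\<dots> = card (Sigma S ?B)" using finS fin j by (intro card_SigmaI [symmetric]) auto
  also have "\<dots> \<le> card (end_pairs E V j)"
  proof (rule card_mono)
    have "end_pairs E V j \<subseteq> V 0 \<times> V j" by (auto simp: end_pairs_def)
    then show "finite (end_pairs E V j)" using fin N j by (meson finite_SigmaI finite_subset)
    show "Sigma S ?B \<subseteq> end_pairs E V j" using S(2) by (auto simp: end_pairs_def)
  qed
  finally show ?thesis .
qed

lemma path_edges_nth: "Suc i < length xs \<Longrightarrow> {xs ! i, xs ! Suc i} \<in> path_edges xs"
proof (induction xs arbitrary: i rule: path_edges.induct)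
  case (1 x y xs)
  then show ?case by (cases i) auto
qed auto

lemma hamiltonian_if_closed:
  assumes "is_path E P" "set P = V" "{hd P, last P} \<in> E" "3 \<le> card V"
  shows "hamiltonian V E"
  unfolding hamiltonian_def
proof (intro exI[of _ P] conjI allI impI)
  show "length P \<ge> 3" using assms length_is_path by metis
  show "distinct P" "set P = V" using assms by (auto simp: is_path_def)
  fix i assume i: "i < length P"
  have ne: "P \<noteq> []" using assms by (auto simp: is_path_def)
  show "{P ! i, P ! (Suc i mod length P)} \<in> E"
  proof (cases "Suc i < length P")
    case True
    then show ?thesis using path_edges_nth[OF True] assms(1) by (auto simp: is_path_def)
  next
    case False
    then have "Suc i = length P" using i by simp
    then have "P ! i = last P" "P ! (Suc i mod length P) = hd P"
      using ne by (auto simp: last_conv_nth hd_conv_nth simp flip: \<open>Suc i = length P\<close>)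
    then show ?thesis using assms(3) by (simp add: insert_commute)
  qed
qed

section \<open>Random subsets\<close>

text \<open>With \<open>A = vertex_pairs n\<close> this is \<open>erdos_renyi n p\<close>; a general
  ground set allows it to be split into an exposed and an untouched part.\<close>

definition random_subset :: "'b set \<Rightarrow> real \<Rightarrow> 'b set pmf" where
  "random_subset A p = map_pmf Collect (Pi_pmf A False (\<lambda>_. bernoulli_pmf p))"

lemma random_subset_Un:
  assumes "finite A" "finite B" "A \<inter> B = {}"
  shows "random_subset (A \<union> B) p =
           map_pmf (\<lambda>(F, G). F \<union> G) (pair_pmf (random_subset A p) (random_subset B p))"
proof -
  let ?P = "\<lambda>A. Pi_pmf A False (\<lambda>_. bernoulli_pmf p)"
  have "random_subset (A \<union> B) p =
          map_pmf (\<lambda>(f, g). Collect (\<lambda>x. if x \<in> A then f x else g x)) (pair_pmf (?P A) (?P B))"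
    unfolding random_subset_def Pi_pmf_union[OF assms] map_pmf_comp by (simp add: case_prod_unfold)
  also have "\<dots> = map_pmf (\<lambda>(f, g). Collect f \<union> Collect g) (pair_pmf (?P A) (?P B))"
  proof (rule map_pmf_cong[OF refl])
    \<comment> \<open>Off its index set a sampled function takes the default \<open>False\<close>;
      only therefore does the glued function collect to the union.\<close>
    fix fg assume "fg \<in> set_pmf (pair_pmf (?P A) (?P B))"
    then have "\<forall>x. x \<notin> A \<longrightarrow> \<not> fst fg x" "\<forall>x. x \<notin> B \<longrightarrow> \<not> snd fg x"
      using set_Pi_pmf_subset[OF assms(1)] set_Pi_pmf_subset[OF assms(2)] by fastforce+
    then show "(case fg of (f, g) \<Rightarrow> {x. if x \<in> A then f x else g x}) =
               (case fg of (f, g) \<Rightarrow> Collect f \<union> Collect g)"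
      using assms(3) by (auto split: prod.splits)
  qed
  also have "\<dots> = map_pmf (\<lambda>(F, G). F \<union> G) (pair_pmf (random_subset A p) (random_subset B p))"
    by (simp add: random_subset_def pair_map_pmf1 pair_map_pmf2 map_pmf_comp case_prod_unfold)
  finally show ?thesis .
qed

lemma set_random_subset: "finite A \<Longrightarrow> F \<in> set_pmf (random_subset A p) \<Longrightarrow> F \<subseteq> A"
  using set_Pi_pmf_subset[of A False "\<lambda>_. bernoulli_pmf p"] unfolding random_subset_def by fastforce

lemma prob_random_subset_avoids:
  assumes "finite A" "C \<subseteq> A" "0 \<le> p" "p \<le> 1"
  shows "measure_pmf.prob (random_subset A p) {F. F \<inter> C = {}} = (1 - p) ^ card C"
proof -
  have "measure_pmf.prob (random_subset A p) {F. F \<inter> C = {}} =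
          measure_pmf.prob (Pi_pmf A False (\<lambda>_. bernoulli_pmf p)) (Pi A (\<lambda>x. if x \<in> C then {False} else UNIV))"
  proof -
    have "Collect -` {F. F \<inter> C = {}} = Pi A (\<lambda>x. if x \<in> C then {False} else UNIV)"
      using assms(2) by (fastforce simp: Pi_iff)
    then show ?thesis unfolding random_subset_def measure_map_pmf by simp
  qed
  also have "\<dots> = (\<Prod>x\<in>A. measure_pmf.prob (bernoulli_pmf p) (if x \<in> C then {False} else UNIV))"
    by (rule measure_Pi_pmf_Pi[OF assms(1)])
  also have "\<dots> = (\<Prod>x\<in>A. if x \<in> C then 1 - p else 1)"
    using assms(3,4) by (intro prod.cong) (auto simp: measure_pmf_single)
  also have "\<dots> = (1 - p) ^ card C"
    using assms(1,2) by (simp add: prod.If_cases Int_absorb1)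
  finally show ?thesis .
qed

text \<open>Exposing the edges outside \<open>B\<close> first determines the set \<open>f F \<subseteq> B\<close>, whose
  elements are then still untouched.\<close>

lemma prob_random_subset_avoids_determined:
  assumes fin: "finite A" and p: "0 \<le> p" "p \<le> 1" and B: "B \<subseteq> A"
    and det: "\<And>F. f F = f (F - B)"
  shows "measure_pmf.prob (random_subset A p)
           {F. f F \<subseteq> B \<and> k \<le> card (f F) \<and> F \<inter> f F = {}} \<le> (1 - p) ^ k"
proof -
  let ?X = "{F. f F \<subseteq> B \<and> k \<le> card (f F) \<and> F \<inter> f F = {}}"
  have finB: "finite B" using B fin finite_subset by blast
  have A: "A = (A - B) \<union> B" using B by auto
  have "random_subset A p =
          bind_pmf (random_subset (A - B) p) (\<lambda>F. map_pmf (\<lambda>G. F \<union> G) (random_subset B p))"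
    by (subst A, subst random_subset_Un)
       (use fin finB in \<open>auto simp: pair_pmf_def map_bind_pmf map_pmf_def bind_assoc_pmf bind_return_pmf\<close>)
  then have "emeasure (random_subset A p) ?X =
          (\<integral>\<^sup>+F. emeasure (map_pmf (\<lambda>G. F \<union> G) (random_subset B p)) ?X \<partial>random_subset (A - B) p)"
    by simp
  also have "\<dots> \<le> (\<integral>\<^sup>+F. ennreal ((1 - p) ^ k) \<partial>random_subset (A - B) p)"
  proof (rule nn_integral_mono_AE, unfold AE_measure_pmf_iff, intro ballI)
    fix F assume "F \<in> set_pmf (random_subset (A - B) p)"
    then have F: "F \<subseteq> A - B" using set_random_subset fin by (metis finite_Diff)
    have f: "f (F \<union> G) = f F" if "G \<subseteq> B" for G
      using det[of "F \<union> G"] det[of F] that by (simp add: Un_Diff Diff_eq_empty_iff[THEN iffD2])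
    \<comment> \<open>With \<open>F\<close> fixed, \<open>f (F \<union> G) = f F\<close> does not
      vary with \<open>G\<close>: either the event is impossible, or \<open>G\<close> has to avoid
      one fixed set.\<close>
    have "measure_pmf.prob (map_pmf (\<lambda>G. F \<union> G) (random_subset B p)) ?X \<le> (1 - p) ^ k"
    proof (cases "f F \<subseteq> B \<and> k \<le> card (f F)")
      case True
      have "measure_pmf.prob (map_pmf (\<lambda>G. F \<union> G) (random_subset B p)) ?X =
              measure_pmf.prob (random_subset B p) {G. F \<union> G \<in> ?X}"
        by (simp add: measure_map_pmf vimage_def)
      also have "\<dots> \<le> measure_pmf.prob (random_subset B p) {G. G \<inter> f F = {}}"
        using f set_random_subset[OF finB]
        by (intro measure_pmf.finite_measure_mono_AE) (auto simp: AE_measure_pmf_iff)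
      also have "\<dots> = (1 - p) ^ card (f F)"
        using True finB p by (intro prob_random_subset_avoids) auto
      also have "\<dots> \<le> (1 - p) ^ k"
        using True p by (intro power_decreasing) auto
      finally show ?thesis .
    next
      case False
      then have "measure_pmf.prob (map_pmf (\<lambda>G. F \<union> G) (random_subset B p)) ?X = 0"
        using f set_random_subset[OF finB] by (subst measure_pmf_zero_iff) auto
      then show ?thesis using p by simp
    qed
    then show "emeasure (map_pmf (\<lambda>G. F \<union> G) (random_subset B p)) ?X \<le> ennreal ((1 - p) ^ k)"
      by (simp add: measure_pmf.emeasure_eq_measure ennreal_leI)
  qed
  also have "\<dots> = ennreal ((1 - p) ^ k)" by simp
  finally show ?thesis using p by (simp add: measure_pmf.emeasure_eq_measure)
qed

section \<open>Union bounds for a single cell and for a pair of cells\<close>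

definition cross :: "'a set \<Rightarrow> 'a set \<Rightarrow> 'a set set" where
  "cross S T = (\<lambda>(x, y). {x, y}) ` (S \<times> T)"

lemma mem_cross: "e \<in> cross S T \<longleftrightarrow> (\<exists>x\<in>S. \<exists>y\<in>T. e = {x, y})"
  unfolding cross_def by auto

lemma inj_on_doubleton: "S \<inter> T = {} \<Longrightarrow> inj_on (\<lambda>(x, y). {x, y}) (S \<times> T)"
  by (auto simp: inj_on_def doubleton_eq_iff)

lemma card_cross: "S \<inter> T = {} \<Longrightarrow> card (cross S T) = card S * card T"
  unfolding cross_def by (simp add: card_image inj_on_doubleton card_cartesian_product)

lemma cross_subset_vertex_pairs:
  "S \<subseteq> {..<n} \<Longrightarrow> T \<subseteq> {..<n} \<Longrightarrow> S \<inter> T = {} \<Longrightarrow> cross S T \<subseteq> vertex_pairs n"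
  by (force simp: mem_cross vertex_pairs_def card_insert_if)

lemma finite_vertex_pairs: "finite (vertex_pairs n)"
  by (rule finite_subset[of _ "Pow {..<n}"]) (auto simp: vertex_pairs_def)

lemma power_one_minus_le_exp:
  fixes p x :: real
  assumes "0 \<le> p" "p \<le> 1" "x \<le> p * real k"
  shows "(1 - p) ^ k \<le> exp (- x)"
proof -
  have "(1 - p) ^ k \<le> exp (- p) ^ k"
    using assms exp_ge_add_one_self[of "- p"] by (intro power_mono) auto
  also have "\<dots> = exp (- (p * real k))" by (simp add: exp_of_nat_mult[symmetric] mult.commute)
  also have "\<dots> \<le> exp (- x)" using assms by simp
  finally show ?thesis .
qed

lemma exp_minus_mult_ln: "0 < n \<Longrightarrow> exp (- (real j * ln (real n))) = 1 / real n ^ j"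
  by (simp add: exp_minus exp_of_nat_mult field_simps)

lemma card_subsets_le: "finite V \<Longrightarrow> card {S. S \<subseteq> V \<and> card S = s} \<le> card V ^ s"
  by (cases "s \<le> card V") (simp_all add: n_subsets binomial_le_pow binomial_eq_0)

lemma prob_no_cross_edge:
  assumes "0 \<le> p" "p \<le> 1" "S \<subseteq> {..<n}" "T \<subseteq> {..<n}" "S \<inter> T = {}"
    and "x \<le> p * (real (card S) * real (card T))"
  shows "measure_pmf.prob (random_subset (vertex_pairs n) p) {F. F \<inter> cross S T = {}} \<le> exp (- x)"
proof -
  have "measure_pmf.prob (random_subset (vertex_pairs n) p) {F. F \<inter> cross S T = {}} =
          (1 - p) ^ (card S * card T)"
    using assms by (subst prob_random_subset_avoids)
      (auto simp: finite_vertex_pairs card_cross cross_subset_vertex_pairs)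
  also have "\<dots> \<le> exp (- x)" using assms by (intro power_one_minus_le_exp) auto
  finally show ?thesis .
qed

text \<open>The constant 1000 is chosen generously: each failure probability below only has to be small
  enough to be summed over at most \<open>n\<close> cells.\<close>

locale dense_vertex_set =
  fixes n :: nat and V :: "nat set" and p :: real
  assumes n2: "2 \<le> n" and sub: "V \<subseteq> {..<n}" and p: "0 \<le> p" "p \<le> 1"
    and dense: "1000 * ln (real n) \<le> p * real (card V)"
begin

lemma fin: "finite V" using sub finite_subset by blast

lemma card_le: "card V \<le> n" using card_mono[OF _ sub] by simp

lemma ln_pos: "0 < ln (real n)" using n2 by simp

lemma card_pos: "0 < card V"
  using dense ln_pos p by (cases "card V = 0") auto

text \<open>Enlarging a small neighbourhood to a set \<open>T\<close> of exactly
  \<open>4 * s\<close> vertices leaves one pair of sizes per \<open>s\<close>, and no edge runs from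
  \<open>S\<close> to the rest of \<open>V\<close>.\<close>

lemma not_expander_subset:
  "{F. \<not> expander F V (card V div 10)} \<subseteq>
     (\<Union>s\<in>{1..card V div 10}. \<Union>(S, T) \<in> {S. S \<subseteq> V \<and> card S = s} \<times> {T. T \<subseteq> V \<and> card T = 4 * s}.
        if S \<inter> T = {} then {F. F \<inter> cross S (V - S - T) = {}} else {})"
proof
  fix F assume "F \<in> {F. \<not> expander F V (card V div 10)}"
  then obtain S where S: "S \<subseteq> V" "S \<noteq> {}" "card S \<le> card V div 10" "card (nbhd F V S) < 4 * card S"
    unfolding expander_def by (auto simp: not_le)
  have "card (V - S) = card V - card S" using S(1) fin by (simp add: card_Diff_subset finite_subset)
  then have "4 * card S \<le> card (V - S)" using S(3) by linarith
  moreover have "nbhd F V S \<subseteq> V - S" by (auto simp: nbhd_def)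
  ultimately obtain T where T: "nbhd F V S \<subseteq> T" "T \<subseteq> V - S" "card T = 4 * card S"
    using exists_subset_between[of "nbhd F V S" "4 * card S" "V - S"] S fin by auto
  have "card S \<in> {1..card V div 10}"
    using S fin by (auto simp: Suc_le_eq card_gt_0_iff intro: finite_subset)
  moreover have "F \<inter> cross S (V - S - T) = {}"
    using T by (fastforce simp: mem_cross nbhd_def)
  ultimately show "F \<in> (\<Union>s\<in>{1..card V div 10}.
      \<Union>(S, T) \<in> {S. S \<subseteq> V \<and> card S = s} \<times> {T. T \<subseteq> V \<and> card T = 4 * s}.
        if S \<inter> T = {} then {F. F \<inter> cross S (V - S - T) = {}} else {})"
    using S T by (intro UN_I[of "card S"] UN_I[of "(S, T)"]) (auto split: if_splits)
qed

text \<open>There are at most \<open>n ^ (5 * s)\<close> pairs \<open>(S, T)\<close>, each failing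
  with probability at most \<open>exp (- 500 * s * ln n)\<close>. What remains is below
  \<open>1 / n ^ 3\<close> for each of at most \<open>n\<close> sizes.\<close>

lemma prob_not_expander:
  "measure_pmf.prob (random_subset (vertex_pairs n) p) {F. \<not> expander F V (card V div 10)} \<le> 1 / real n ^ 2"
proof -
  let ?P = "measure_pmf.prob (random_subset (vertex_pairs n) p)"
  let ?k = "card V div 10"
  let ?I = "\<lambda>s. {S. S \<subseteq> V \<and> card S = s} \<times> {T. T \<subseteq> V \<and> card T = 4 * s}"
  let ?A = "\<lambda>S T. if S \<inter> T = {} then {F. F \<inter> cross S (V - S - T) = {}} else {}"
  have finI: "finite (?I s)" for s using fin by auto
  have A: "?P (?A S T) \<le> exp (- (real s * (500 * ln (real n))))"
    if "s \<in> {1..?k}" "(S, T) \<in> ?I s" for s S T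
  proof (cases "S \<inter> T = {}")
    case True
    have ST: "S \<subseteq> V" "T \<subseteq> V" "card S = s" "card T = 4 * s" using that by auto
    have finS: "finite S" "finite T" using ST fin finite_subset by blast+
    have "V - S - T = V - (S \<union> T)" by auto
    then have "card (V - S - T) = card V - card (S \<union> T)"
      using ST finS by (simp add: card_Diff_subset)
    moreover have "10 * s \<le> card V" using that(1) by (simp add: less_eq_div_iff_mult_less_eq)
    \<comment> \<open>\<open>S\<close> and \<open>T\<close> together have \<open>5 * s\<close>
      vertices, at most half of \<open>V\<close>; this halves the constant 1000.\<close>
    ultimately have "card V \<le> 2 * card (V - S - T)"
      using True ST finS by (simp add: card_Un_disjoint)
    then have "p * real (card V) \<le> p * (2 * real (card (V - S - T)))"
      using p by (intro mult_left_mono) linarith+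
    then have "500 * ln (real n) \<le> p * real (card (V - S - T))" using dense by linarith
    then have "real s * (500 * ln (real n)) \<le> real s * (p * real (card (V - S - T)))"
      by (rule mult_left_mono) simp
    then have "?P {F. F \<inter> cross S (V - S - T) = {}} \<le> exp (- (real s * (500 * ln (real n))))"
      using p ST sub by (intro prob_no_cross_edge) (auto simp: mult_ac)
    then show ?thesis using True by simp
  qed simp
  have term_bound: "?P (\<Union>(S, T)\<in>?I s. ?A S T) \<le> 1 / real n ^ 3" if s: "s \<in> {1..?k}" for s
  proof -
    have "?P (\<Union>(S, T)\<in>?I s. ?A S T) \<le> (\<Sum>x\<in>?I s. ?P (case x of (S, T) \<Rightarrow> ?A S T))"
      by (rule measure_UNION_le[OF finI]) auto
    also have "\<dots> \<le> (\<Sum>x\<in>?I s. exp (- (real s * (500 * ln (real n)))))"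
      using A[OF s] by (intro sum_mono) (auto simp del: mem_Collect_eq)
    also have "\<dots> = real (card (?I s)) * exp (- (real s * (500 * ln (real n))))" by simp
    also have "\<dots> \<le> real (n ^ (5 * s)) * exp (- (real s * (500 * ln (real n))))"
    proof (intro mult_right_mono of_nat_mono)
      have "card (?I s) \<le> card V ^ s * card V ^ (4 * s)"
        unfolding card_cartesian_product using fin by (intro mult_mono card_subsets_le) auto
      also have "\<dots> = card V ^ (5 * s)" by (simp flip: power_add)
      also have "\<dots> \<le> n ^ (5 * s)" using card_le by (rule power_mono) simp
      finally show "card (?I s) \<le> n ^ (5 * s)" .
    qed simp
    also have "real (n ^ (5 * s)) = exp (real s * (5 * ln (real n)))"
    proof -
      have "real (n ^ (5 * s)) = exp (ln (real n)) ^ (5 * s)" using n2 by simp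
      also have "\<dots> = exp (real s * (5 * ln (real n)))"
        by (simp flip: exp_of_nat_mult add: mult_ac)
      finally show ?thesis .
    qed
    also have "\<dots> * exp (- (real s * (500 * ln (real n)))) = exp (- (real s * (495 * ln (real n))))"
      by (simp flip: exp_add add: algebra_simps)
    also have "\<dots> \<le> exp (- (real 3 * ln (real n)))"
    proof -
      have "1 * (3 * ln (real n)) \<le> real s * (495 * ln (real n))"
        using s ln_pos by (intro mult_mono) auto
      then show ?thesis by simp
    qed
    also have "\<dots> = 1 / real n ^ 3" using n2 by (intro exp_minus_mult_ln) simp
    finally show ?thesis .
  qed
  have "?P {F. \<not> expander F V ?k} \<le> ?P (\<Union>s\<in>{1..?k}. \<Union>(S, T)\<in>?I s. ?A S T)"
    using not_expander_subset by (intro measure_pmf.finite_measure_mono) auto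
  also have "\<dots> \<le> (\<Sum>s\<in>{1..?k}. ?P (\<Union>(S, T)\<in>?I s. ?A S T))"
    by (rule measure_UNION_le) auto
  also have "\<dots> \<le> (\<Sum>s\<in>{1..?k}. 1 / real n ^ 3)" by (intro sum_mono term_bound)
  also have "\<dots> = real ?k * (1 / real n ^ 3)" by simp
  also have "\<dots> \<le> real n * (1 / real n ^ 3)" using card_le by (intro mult_right_mono) auto
  also have "\<dots> = 1 / real n ^ 2" using n2 by (simp add: field_simps power2_eq_square power3_eq_cube)
  finally show ?thesis .
qed

text \<open>For fixed \<open>v\<close> the pairs from \<open>v\<close> to the longest ends are
  determined by edges avoiding \<open>v\<close>. More than a tenth of \<open>card V\<close> fresh
  pairs all fail with probability at most \<open>exp (- 100 * ln n)\<close>, of which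
  \<open>1 / n ^ 3\<close> is kept for the sum over \<open>v\<close>.\<close>

lemma prob_not_hit:
  "measure_pmf.prob (random_subset (vertex_pairs n) p)
     {F. \<exists>v\<in>V. card V div 10 < card (longest_ends F (V - {v})) \<and>
          \<not> (\<exists>t \<in> longest_ends F (V - {v}). {v, t} \<in> F)} \<le> 1 / real n ^ 2"
  (is "_ {F. \<exists>v\<in>V. ?bad v F} \<le> _")
proof -
  let ?P = "measure_pmf.prob (random_subset (vertex_pairs n) p)" and ?k = "card V div 10"
  have bad: "?P {F. ?bad v F} \<le> 1 / real n ^ 3" if v: "v \<in> V" for v
  proof -
    let ?f = "\<lambda>F. cross {v} (longest_ends F (V - {v}))"
    let ?B = "cross {v} (V - {v})"
    have card_f: "card (?f F) = card (longest_ends F (V - {v}))" for F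
      using longest_ends_subset[of F "V - {v}"] by (subst card_cross) auto
    have "?P {F. ?bad v F} \<le> ?P {F. ?f F \<subseteq> ?B \<and> Suc ?k \<le> card (?f F) \<and> F \<inter> ?f F = {}}"
    proof (intro measure_pmf.finite_measure_mono subsetI)
      fix F assume F: "F \<in> {F. ?bad v F}"
      have "?f F \<subseteq> ?B" using longest_ends_subset[of F "V - {v}"] by (auto simp: cross_def)
      moreover have "F \<inter> ?f F = {}" using F by (auto simp: mem_cross)
      ultimately show "F \<in> {F. ?f F \<subseteq> ?B \<and> Suc ?k \<le> card (?f F) \<and> F \<inter> ?f F = {}}"
        using F by (simp add: card_f)
    qed auto
    also have "\<dots> \<le> (1 - p) ^ Suc ?k"
    proof (rule prob_random_subset_avoids_determined[OF finite_vertex_pairs p])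
      show "?B \<subseteq> vertex_pairs n" using v sub by (intro cross_subset_vertex_pairs) auto
      show "?f F = ?f (F - ?B)" for F
        by (intro arg_cong[of _ _ "cross {v}"] longest_ends_cong) (auto simp: mem_cross)
    qed
    also have "\<dots> \<le> exp (- (real 3 * ln (real n)))"
    proof (rule power_one_minus_le_exp[OF p])
      have "card V \<le> 10 * Suc ?k" using dividend_less_times_div[of 10 "card V"] by simp
      then have "real (card V) \<le> 10 * real (Suc ?k)" by linarith
      then have "p * real (card V) \<le> p * (10 * real (Suc ?k))"
        using p by (intro mult_left_mono) auto
      then show "real 3 * ln (real n) \<le> p * real (Suc ?k)" using dense ln_pos by linarith
    qed
    also have "\<dots> = 1 / real n ^ 3" using n2 by (intro exp_minus_mult_ln) simp
    finally show ?thesis .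
  qed
  have "{F. \<exists>v\<in>V. ?bad v F} = (\<Union>v\<in>V. {F. ?bad v F})" by auto
  then have "?P {F. \<exists>v\<in>V. ?bad v F} = ?P (\<Union>v\<in>V. {F. ?bad v F})" by (rule arg_cong)
  also have "\<dots> \<le> (\<Sum>v\<in>V. ?P {F. ?bad v F})"
    by (rule measure_UNION_le[OF fin]) simp
  also have "\<dots> \<le> (\<Sum>v\<in>V. 1 / real n ^ 3)" by (intro sum_mono bad)
  also have "\<dots> = real (card V) * (1 / real n ^ 3)" by simp
  also have "\<dots> \<le> real n * (1 / real n ^ 3)" using card_le by (intro mult_right_mono) auto
  also have "\<dots> = 1 / real n ^ 2" using n2 by (simp add: field_simps power2_eq_square power3_eq_cube)
  finally show ?thesis .
qed

end

text \<open>With \<open>m = card V + card W\<close> there are at most \<open>2 ^ m <= n ^ m\<close>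
  pairs of subsets, against a failure probability of \<open>exp (- 5 * m * ln n)\<close> for
  each.\<close>

lemma prob_not_joined:
  assumes V: "dense_vertex_set n V p" and W: "dense_vertex_set n W p" and disj: "V \<inter> W = {}"
  shows "measure_pmf.prob (random_subset (vertex_pairs n) p)
           {F. \<not> joined F V (card V div 10) W (card W div 10)} \<le> 1 / real n ^ 2"
proof -
  let ?P = "measure_pmf.prob (random_subset (vertex_pairs n) p)"
  interpret V: dense_vertex_set n V p by fact
  interpret W: dense_vertex_set n W p by fact
  let ?k = "card V div 10" and ?l = "card W div 10"
  let ?m = "real (card V) + real (card W)"
  let ?A = "\<lambda>S T. if ?k < card S \<and> ?l < card T then {F. F \<inter> cross S T = {}} else {}"
  have A: "?P (?A S T) \<le> exp (- (5 * ?m * ln (real n)))" if ST: "S \<subseteq> V" "T \<subseteq> W" for S T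
  proof (cases "?k < card S \<and> ?l < card T")
    case True
    have "card V \<le> 10 * card S" "card W \<le> 10 * card T"
      using True by (auto simp: div_less_iff_less_mult)
    then have "real (card V) \<le> 10 * real (card S)" "real (card W) \<le> 10 * real (card T)"
      by linarith+
    then have "real (card V) * real (card W) \<le> (10 * real (card S)) * (10 * real (card T))"
      by (intro mult_mono) auto
    then have "p * (real (card V) * real (card W)) \<le> p * (100 * (real (card S) * real (card T)))"
      using V.p by (intro mult_left_mono) auto
    \<comment> \<open>Averaging the density bounds of the two cells gives
      \<open>p * card V * card W >= 500 * m * ln n\<close>; passing to tenths on both sides divides
      by 100.\<close>
    moreover have "1000 * ln (real n) * real (card W) \<le> p * real (card V) * real (card W)"
      using V.dense by (intro mult_right_mono) auto
    moreover have "1000 * ln (real n) * real (card V) \<le> p * real (card W) * real (card V)"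
      using W.dense by (intro mult_right_mono) auto
    ultimately have "5 * ?m * ln (real n) \<le> p * (real (card S) * real (card T))"
      by (simp add: algebra_simps)
    then have "?P {F. F \<inter> cross S T = {}} \<le> exp (- (5 * ?m * ln (real n)))"
      using ST V.sub W.sub disj V.p by (intro prob_no_cross_edge) auto
    then show ?thesis using True by simp
  qed auto
  have "?P {F. \<not> joined F V ?k W ?l} \<le> ?P (\<Union>(S, T)\<in>Pow V \<times> Pow W. ?A S T)"
  proof (intro measure_pmf.finite_measure_mono subsetI)
    fix F assume "F \<in> {F. \<not> joined F V ?k W ?l}"
    then obtain S T where ST: "S \<subseteq> V" "T \<subseteq> W" "?k < card S" "?l < card T"
      "\<forall>x\<in>S. \<forall>y\<in>T. {x, y} \<notin> F" unfolding joined_def by auto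
    then have "F \<inter> cross S T = {}" by (auto simp: mem_cross)
    then show "F \<in> (\<Union>(S, T)\<in>Pow V \<times> Pow W. ?A S T)"
      using ST by (intro UN_I[of "(S, T)"]) auto
  qed auto
  also have "\<dots> \<le> (\<Sum>x\<in>Pow V \<times> Pow W. ?P (case x of (S, T) \<Rightarrow> ?A S T))"
    using V.fin W.fin by (intro measure_UNION_le) auto
  also have "\<dots> \<le> (\<Sum>x\<in>Pow V \<times> Pow W. exp (- (5 * ?m * ln (real n))))"
    using A by (intro sum_mono) (auto simp del: mem_Collect_eq)
  also have "\<dots> = 2 ^ (card V + card W) * exp (- (5 * ?m * ln (real n)))"
    using V.fin W.fin by (simp add: card_cartesian_product card_Pow power_add)
  also have "\<dots> \<le> real n ^ (card V + card W) * exp (- (5 * ?m * ln (real n)))"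
    using V.n2 by (intro mult_right_mono power_mono) auto
  also have "real n ^ (card V + card W) = exp (ln (real n)) ^ (card V + card W)" using V.n2 by simp
  also have "\<dots> = exp (?m * ln (real n))" by (simp flip: exp_of_nat_mult)
  also have "exp (?m * ln (real n)) * exp (- (5 * ?m * ln (real n))) = exp (- (4 * ?m * ln (real n)))"
    by (simp flip: exp_add add: algebra_simps)
  also have "\<dots> \<le> exp (- (real 2 * ln (real n)))"
  proof -
    have "1 \<le> real (card V)" using V.card_pos by linarith
    then have "2 * ln (real n) \<le> (4 * ?m) * ln (real n)"
      using V.ln_pos by (intro mult_right_mono) auto
    then show ?thesis by simp
  qed
  also have "\<dots> = 1 / real n ^ 2" using V.n2 by (intro exp_minus_mult_ln) simp
  finally show ?thesis .
qed

section \<open>Chains of dense cells\<close>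

text \<open>No geometry enters here, only a chain of dense cells. With \<open>N >= 3\<close> the
  first and the last cell are not consecutive in the chain, which keeps the closing pairs apart from
  the inner ones.\<close>

locale cell_partition =
  fixes n N :: nat and V :: "nat \<Rightarrow> nat set" and p :: real
  assumes n2: "2 \<le> n" and N3: "3 \<le> N" and p: "0 \<le> p" "p \<le> 1"
    and cover: "(\<Union>i<N. V i) = {..<n}"
    and disj: "\<And>i j. i < N \<Longrightarrow> j < N \<Longrightarrow> i \<noteq> j \<Longrightarrow> V i \<inter> V j = {}"
    and dense: "\<And>i. i < N \<Longrightarrow> 1000 * ln (real n) \<le> p * real (card (V i))"
begin

lemma dense_cell: "i < N \<Longrightarrow> dense_vertex_set n (V i) p"
  using n2 p cover dense by unfold_locales auto

lemma fin: "i < N \<Longrightarrow> finite (V i)"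
  using dense_vertex_set.fin dense_cell by blast

text \<open>Dense cells are nonempty. Hence a union bound over cells costs at most a factor
  \<open>n\<close>.\<close>

lemma N_le: "N \<le> n"
proof -
  have "N = (\<Sum>i<N. 1)" by simp
  also have "\<dots> \<le> (\<Sum>i<N. card (V i))"
    using dense_vertex_set.card_pos[OF dense_cell] by (intro sum_mono) (auto simp: Suc_le_eq)
  also have "\<dots> = card (\<Union>i<N. V i)"
    using fin disj by (intro card_UN_disjoint [symmetric]) auto
  finally show ?thesis by (simp add: cover)
qed

text \<open>The pairs joining the first cell to the last one are left out: the edges among them stay
  independent of everything else, and close the cycle.\<close>

definition inner_pairs :: "nat set set" where
  "inner_pairs = {e. (\<exists>i<N. e \<subseteq> V i) \<or> (\<exists>i. Suc i < N \<and> e \<in> cross (V i) (V (Suc i)))}"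

definition closing_pairs :: "nat set set \<Rightarrow> nat set set" where
  "closing_pairs F = (\<lambda>(s, t). {s, t}) ` end_pairs (F \<inter> inner_pairs) V (N - 1)"

lemma end_pairs_subset: "end_pairs E V j \<subseteq> V 0 \<times> V j"
  by (auto simp: end_pairs_def)

lemma closing_pairs_subset: "closing_pairs F \<subseteq> cross (V 0) (V (N - 1))"
  unfolding closing_pairs_def cross_def by (intro image_mono end_pairs_subset)

lemma ends_disjoint: "V 0 \<inter> V (N - 1) = {}"
  using N3 by (intro disj) auto

lemma card_closing_pairs: "card (closing_pairs F) = card (end_pairs (F \<inter> inner_pairs) V (N - 1))"
  unfolding closing_pairs_def
  by (intro card_image inj_on_subset[OF inj_on_doubleton end_pairs_subset] ends_disjoint)

lemma inner_pairs_disjoint: "inner_pairs \<inter> cross (V 0) (V (N - 1)) = {}"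
proof (rule ccontr)
  assume "\<not> ?thesis"
  then obtain x y where xy: "x \<in> V 0" "y \<in> V (N - 1)" "{x, y} \<in> inner_pairs"
    by (auto simp: mem_cross)
  have cell: "i = j" if "z \<in> V i" "z \<in> V j" "i < N" "j < N" for i j z
    using disj that by blast
  from xy(3) show False unfolding inner_pairs_def
  proof (clarify, elim disjE exE conjE)
    fix i assume "i < N" "{x, y} \<subseteq> V i"
    then have "0 = i" "N - 1 = i" using cell[of x 0 i] cell[of y "N - 1" i] xy N3 by auto
    then show False using N3 by simp
  next
    fix i assume i: "Suc i < N" "{x, y} \<in> cross (V i) (V (Suc i))"
    then have "x \<in> V i \<and> y \<in> V (Suc i) \<or> y \<in> V i \<and> x \<in> V (Suc i)"
      by (auto simp: mem_cross doubleton_eq_iff)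
    then show False
      using cell[of x 0 i] cell[of y "N - 1" "Suc i"] cell[of y "N - 1" i] cell[of x 0 "Suc i"] xy i N3
      by auto
  qed
qed

lemma prob_not_closed:
  "measure_pmf.prob (random_subset (vertex_pairs n) p)
     {F. Suc (card (V 0) div 10) * Suc (card (V (N - 1)) div 10) \<le> card (closing_pairs F) \<and>
         F \<inter> closing_pairs F = {}} \<le> 1 / real n ^ 2"
proof -
  let ?P = "measure_pmf.prob (random_subset (vertex_pairs n) p)"
  let ?B = "cross (V 0) (V (N - 1))"
  let ?k = "Suc (card (V 0) div 10) * Suc (card (V (N - 1)) div 10)"
  interpret V: dense_vertex_set n "V 0" p using N3 by (intro dense_cell) auto
  interpret W: dense_vertex_set n "V (N - 1)" p using N3 by (intro dense_cell) auto
  have "?P {F. ?k \<le> card (closing_pairs F) \<and> F \<inter> closing_pairs F = {}} =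
        ?P {F. closing_pairs F \<subseteq> ?B \<and> ?k \<le> card (closing_pairs F) \<and> F \<inter> closing_pairs F = {}}"
    using closing_pairs_subset by simp
  also have "\<dots> \<le> (1 - p) ^ ?k"
  proof (rule prob_random_subset_avoids_determined[OF finite_vertex_pairs p])
    show "?B \<subseteq> vertex_pairs n"
      using V.sub W.sub ends_disjoint by (rule cross_subset_vertex_pairs)
    show "closing_pairs F = closing_pairs (F - ?B)" for F
    proof -
      have "F \<inter> inner_pairs = (F - ?B) \<inter> inner_pairs" using inner_pairs_disjoint by auto
      then show ?thesis unfolding closing_pairs_def by simp
    qed
  qed
  also have "\<dots> \<le> exp (- (real 2 * ln (real n)))"
  proof (rule power_one_minus_le_exp[OF p])
    \<comment> \<open>One factor of the product already exceeds a tenth of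
      \<open>card (V 0)\<close>, so the density of the first cell alone yields the exponent.\<close>
    have "card (V 0) \<le> 10 * ?k"
      using dividend_less_times_div[of 10 "card (V 0)"] by simp
    then have "real (card (V 0)) \<le> 10 * real ?k" by linarith
    then have "p * real (card (V 0)) \<le> p * (10 * real ?k)" using p by (intro mult_left_mono) auto
    then show "real 2 * ln (real n) \<le> p * real ?k" using V.dense V.ln_pos by linarith
  qed
  also have "\<dots> = 1 / real n ^ 2" using n2 by (intro exp_minus_mult_ln) simp
  finally show ?thesis .
qed

text \<open>The last clause is conditional because the first three force its premise; in this form
  its negation is exactly the event bounded by \<open>prob_not_closed\<close>.\<close>

definition nice :: "nat set set \<Rightarrow> bool" where
  "nice F \<longleftrightarrow>
     (\<forall>i<N. expander F (V i) (card (V i) div 10)) \<and>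
     (\<forall>i<N. \<forall>v\<in>V i. card (V i) div 10 < card (longest_ends F (V i - {v})) \<longrightarrow>
        (\<exists>t \<in> longest_ends F (V i - {v}). {v, t} \<in> F)) \<and>
     (\<forall>i. Suc i < N \<longrightarrow> joined F (V i) (card (V i) div 10) (V (Suc i)) (card (V (Suc i)) div 10)) \<and>
     (Suc (card (V 0) div 10) * Suc (card (V (N - 1)) div 10) \<le> card (closing_pairs F) \<longrightarrow>
        F \<inter> closing_pairs F \<noteq> {})"

text \<open>\<open>A\<close> stands for the geometric graph. As \<open>inner_pairs\<close> contains
  every subset of a cell, also those that are not pairs, the inclusion in \<open>A\<close> is stated
  within \<open>vertex_pairs n\<close>.\<close>

lemma hamiltonian_if_nice:
  assumes "nice F" and A: "inner_pairs \<inter> vertex_pairs n \<subseteq> A" "cross (V 0) (V (N - 1)) \<subseteq> A"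
    and F: "F \<subseteq> vertex_pairs n"
  shows "hamiltonian {..<n} (A \<inter> F)"
proof -
  let ?E = "F \<inter> inner_pairs" and ?k = "\<lambda>i. card (V i) div 10"
  \<comment> \<open>The path is built in \<open>?E\<close>, the graph from which
    \<open>closing_pairs F\<close> is computed. Inside a cell it agrees with \<open>F\<close>, so
    the properties in \<open>nice F\<close> carry over.\<close>
  have inner: "e \<in> F \<longleftrightarrow> e \<in> ?E" if "e \<subseteq> V i" "i < N" for e i
    using that by (auto simp: inner_pairs_def)
  have exp: "expander ?E (V i) (?k i)" if "i < N" for i
  proof -
    have "nbhd ?E (V i) S = nbhd F (V i) S" if "S \<subseteq> V i" for S
      using inner[of "{_, _}" i] that \<open>i < N\<close> unfolding nbhd_def by blast
    then show ?thesis using \<open>nice F\<close> \<open>i < N\<close> unfolding nice_def expander_def by metis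
  qed
  have ex: "\<exists>P. is_path ?E P \<and> set P = V i" if i: "i < N" for i
  proof (rule ham_path_exists[OF fin[OF i] _ exp[OF i]])
    show "V i \<noteq> {}" using dense_vertex_set.card_pos[OF dense_cell[OF i]] by auto
    fix v assume v: "v \<in> V i"
    have eq: "longest_ends ?E (V i - {v}) = longest_ends F (V i - {v})"
      using inner[OF _ i] by (intro longest_ends_cong) blast
    assume "?k i < card (longest_ends ?E (V i - {v}))"
    then obtain t where t: "t \<in> longest_ends F (V i - {v})" "{v, t} \<in> F"
      using \<open>nice F\<close> i v unfolding nice_def eq by blast
    then have "{v, t} \<subseteq> V i" using v longest_ends_subset[of F "V i - {v}"] by auto
    then show "\<exists>t \<in> longest_ends ?E (V i - {v}). {v, t} \<in> ?E"
      using t inner[OF _ i] unfolding eq by blast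
  qed
  have join: "joined ?E (V i) (?k i) (V (Suc i)) (?k (Suc i))" if i: "Suc i < N" for i
  proof -
    have "{x, y} \<in> ?E" if "x \<in> V i" "y \<in> V (Suc i)" "{x, y} \<in> F" for x y
      using that i by (auto simp: inner_pairs_def mem_cross)
    moreover have "joined F (V i) (?k i) (V (Suc i)) (?k (Suc i))"
      using \<open>nice F\<close> i unfolding nice_def by blast
    ultimately show ?thesis unfolding joined_def by (meson subsetD)
  qed
  have "Suc (?k 0) * Suc (?k (N - 1)) \<le> card (end_pairs ?E V (N - 1))"
    using fin disj ex exp join N3 by (intro card_end_pairs[where N = N]) auto
  then obtain s t where st: "(s, t) \<in> end_pairs ?E V (N - 1)" "{s, t} \<in> F"
    using \<open>nice F\<close> unfolding nice_def card_closing_pairs by (auto simp: closing_pairs_def)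
  have "{..N - 1} = {..<N}" using N3 by auto
  then have U: "(\<Union>i\<le>N - 1. V i) = {..<n}" using cover by simp
  obtain P where P: "is_path ?E P" "set P = {..<n}" "hd P = s" "last P = t"
    using st(1) unfolding end_pairs_def ham_ends_def U by auto
  show ?thesis
  proof (rule hamiltonian_if_closed)
    have "?E \<subseteq> A \<inter> F" using A F by auto
    then show "is_path (A \<inter> F) P" using P unfolding is_path_def by blast
    show "set P = {..<n}" by fact
    have "{s, t} \<in> cross (V 0) (V (N - 1))"
      using st(1) by (auto simp: mem_cross end_pairs_def)
    then show "{hd P, last P} \<in> A \<inter> F" using A st P by auto
    show "3 \<le> card {..<n}" using N3 N_le by simp
  qed
qed

lemma prob_not_nice:
  "measure_pmf.prob (random_subset (vertex_pairs n) p) {F. \<not> nice F} \<le> 4 / real n"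
proof -
  let ?P = "measure_pmf.prob (random_subset (vertex_pairs n) p)"
  let ?A = "\<lambda>i. {F. \<not> expander F (V i) (card (V i) div 10)}"
  let ?B = "\<lambda>i. {F. \<exists>v\<in>V i. card (V i) div 10 < card (longest_ends F (V i - {v})) \<and>
          \<not> (\<exists>t \<in> longest_ends F (V i - {v}). {v, t} \<in> F)}"
  let ?C = "\<lambda>i. {F. \<not> joined F (V i) (card (V i) div 10) (V (Suc i)) (card (V (Suc i)) div 10)}"
  let ?D = "{F. Suc (card (V 0) div 10) * Suc (card (V (N - 1)) div 10) \<le> card (closing_pairs F) \<and>
         F \<inter> closing_pairs F = {}}"
  have UN: "?P (\<Union>i<M. X i) \<le> 1 / real n" if "\<And>i. i < M \<Longrightarrow> ?P (X i) \<le> 1 / real n ^ 2" "M \<le> n" for X M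
  proof -
    have "?P (\<Union>i<M. X i) \<le> (\<Sum>i<M. ?P (X i))" by (rule measure_UNION_le) auto
    also have "\<dots> \<le> (\<Sum>i<M. 1 / real n ^ 2)" using that by (intro sum_mono) auto
    also have "\<dots> = real M * (1 / real n ^ 2)" by simp
    also have "\<dots> \<le> real n * (1 / real n ^ 2)" using that by (intro mult_right_mono) auto
    also have "\<dots> = 1 / real n" using n2 by (simp add: power2_eq_square)
    finally show ?thesis .
  qed
  have A: "?P (\<Union>i<N. ?A i) \<le> 1 / real n"
    using dense_vertex_set.prob_not_expander[OF dense_cell] N_le by (intro UN) auto
  have B: "?P (\<Union>i<N. ?B i) \<le> 1 / real n"
    using dense_vertex_set.prob_not_hit[OF dense_cell] N_le by (intro UN) auto
  have C: "?P (\<Union>i<N - 1. ?C i) \<le> 1 / real n"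
  proof (rule UN)
    fix i assume "i < N - 1"
    then have "i < N" "Suc i < N" by auto
    then show "?P (?C i) \<le> 1 / real n ^ 2" by (intro prob_not_joined dense_cell disj) auto
  qed (use N_le in auto)
  have D: "?P ?D \<le> 1 / real n"
  proof -
    have "real n * 1 \<le> real n * real n" using n2 by (intro mult_left_mono) auto
    then have "1 / real n ^ 2 \<le> 1 / real n"
      using n2 by (intro divide_left_mono) (auto simp: power2_eq_square)
    then show ?thesis using prob_not_closed by linarith
  qed
  have "{F. \<not> nice F} \<subseteq> ((\<Union>i<N. ?A i) \<union> (\<Union>i<N. ?B i)) \<union> ((\<Union>i<N - 1. ?C i) \<union> ?D)"
    unfolding nice_def by (auto simp: less_diff_conv)
  then have "?P {F. \<not> nice F} \<le> ?P (((\<Union>i<N. ?A i) \<union> (\<Union>i<N. ?B i)) \<union> ((\<Union>i<N - 1. ?C i) \<union> ?D))"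
    by (intro measure_pmf.finite_measure_mono) auto
  also have "\<dots> \<le> (?P (\<Union>i<N. ?A i) + ?P (\<Union>i<N. ?B i)) + (?P (\<Union>i<N - 1. ?C i) + ?P ?D)"
    by (intro order_trans[OF measure_Un_le] add_mono measure_Un_le) auto
  also have "\<dots> \<le> 4 / real n" using A B C D by simp
  finally show ?thesis .
qed

lemma prob_hamiltonian:
  assumes "inner_pairs \<inter> vertex_pairs n \<subseteq> A" "cross (V 0) (V (N - 1)) \<subseteq> A"
  shows "1 - 4 / real n \<le>
    measure_pmf.prob (random_subset (vertex_pairs n) p) {F. hamiltonian {..<n} (A \<inter> F)}"
proof -
  let ?P = "measure_pmf.prob (random_subset (vertex_pairs n) p)"
  have "1 - 4 / real n \<le> 1 - ?P {F. \<not> nice F}" using prob_not_nice by simp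
  also have "\<dots> = ?P {F. nice F}"
    using measure_pmf.prob_compl[of "{F. \<not> nice F}" "random_subset (vertex_pairs n) p"]
    by (simp add: Compl_eq_Diff_UNIV[symmetric] Collect_neg_eq[symmetric])
  also have "\<dots> \<le> ?P {F. hamiltonian {..<n} (A \<inter> F)}"
    using hamiltonian_if_nice[OF _ assms] set_random_subset[OF finite_vertex_pairs]
    by (intro measure_pmf.finite_measure_mono_AE) (auto simp: AE_measure_pmf_iff)
  finally show ?thesis .
qed

end

section \<open>Cells of the torus\<close>

text \<open>Passing from the Euclidean norm to the sum of the coordinates lets each coordinate
  choose its own integer shift.\<close>

lemma torus_dist_le:
  assumes "z \<in> \<int>" "w \<in> \<int>"
  shows "torus_dist x y \<le> \<bar>fst x - (fst y + z)\<bar> + \<bar>snd x - (snd y + w)\<bar>"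
proof -
  have "torus_dist x y \<le> dist x (y + (z, w))"
    unfolding torus_dist_def using assms
    by (intro cINF_lower bdd_belowI[of _ 0]) auto
  also have "\<dots> \<le> \<bar>fst x - (fst y + z)\<bar> + \<bar>snd x - (snd y + w)\<bar>"
    using sqrt_sum_squares_le_sum_abs[of "fst x - (fst y + z)" "snd x - (snd y + w)"]
    by (simp add: dist_prod_def dist_real_def)
  finally show ?thesis .
qed

lemma borel_measurable_torus_dist [measurable]:
  assumes [measurable]: "f \<in> borel_measurable M" "g \<in> borel_measurable M"
  shows "(\<lambda>x. torus_dist (f x) (g x)) \<in> borel_measurable M"
proof -
  have "countable (\<int> \<times> \<int> :: (real \<times> real) set)"
    unfolding Ints_def by (intro countable_SIGMA countable_image) auto
  then show ?thesis unfolding torus_dist_def by measurable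
qed

text \<open>Reducing modulo \<open>k\<close> identifies coordinate 1 with 0 and gives every real a
  strip, so no null set of positions has to be excluded.\<close>

definition strip :: "nat \<Rightarrow> real \<Rightarrow> nat" where
  "strip k x = nat (\<lfloor>real k * x\<rfloor> mod int k)"

text \<open>Cell \<open>a + k * b\<close> is the square in column \<open>a\<close> and row \<open>b\<close>. In this numbering consecutive
  cells, and also the last and the first cell, touch on the torus, at least in a corner.\<close>

definition cell :: "nat \<Rightarrow> real \<times> real \<Rightarrow> nat" where
  "cell k x = strip k (fst x) + k * strip k (snd x)"

lemma int_strip: "0 < k \<Longrightarrow> int (strip k x) = \<lfloor>real k * x\<rfloor> mod int k"
  by (simp add: strip_def)

lemma strip_less: "0 < k \<Longrightarrow> strip k x < k"
  by (simp add: strip_def nat_less_iff)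

text \<open>After scaling by \<open>k\<close>, the two fractional parts differ by less than 1 and
  \<open>d\<close> adds at most 1. Multiples of \<open>k\<close> lost in the wrap-around become the
  shift \<open>z\<close>.\<close>

lemma strip_close:
  assumes k: "0 < k" and y: "strip k y = (strip k x + d) mod k" and d: "d \<le> 1"
  shows "\<exists>z\<in>\<int>. \<bar>x - (y + z)\<bar> \<le> 2 / real k"
proof -
  have "int (strip k y) = (int (strip k x) + int d) mod int k"
    unfolding y by (simp add: zmod_int)
  then have "\<lfloor>real k * y\<rfloor> mod int k = (\<lfloor>real k * x\<rfloor> + int d) mod int k"
    unfolding int_strip[OF k] by (simp add: mod_add_left_eq)
  then obtain q where "\<lfloor>real k * x\<rfloor> + int d - \<lfloor>real k * y\<rfloor> = int k * q"
    by (metis dvdE mod_eq_dvd_iff)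
  then have q: "real_of_int \<lfloor>real k * x\<rfloor> + real d - real_of_int \<lfloor>real k * y\<rfloor> = real k * real_of_int q"
    by (metis of_int_add of_int_diff of_int_mult of_int_of_nat_eq)
  have "real_of_int \<lfloor>real k * x\<rfloor> \<le> real k * x" "real k * x < real_of_int \<lfloor>real k * x\<rfloor> + 1"
    "real_of_int \<lfloor>real k * y\<rfloor> \<le> real k * y" "real k * y < real_of_int \<lfloor>real k * y\<rfloor> + 1" by linarith+
  moreover have "real d \<le> 1" "real d \<ge> 0" using d by auto
  ultimately have "\<bar>real k * x - real k * y - real k * real_of_int q\<bar> \<le> 2" using q by linarith
  moreover have "real k * x - real k * y - real k * real_of_int q = real k * (x - (y + real_of_int q))"
    by (simp add: algebra_simps)
  ultimately have "real k * \<bar>x - (y + real_of_int q)\<bar> \<le> 2" by (simp add: abs_mult)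
  then have "\<bar>x - (y + real_of_int q)\<bar> \<le> 2 / real k" using k by (simp add: field_simps)
  then show ?thesis by (intro bexI[of _ "real_of_int q"]) auto
qed

lemma cell_mod_div:
  assumes "0 < k"
  shows "cell k x mod k = strip k (fst x)" "cell k x div k = strip k (snd x)"
  using strip_less[OF assms, of "fst x"] assms by (auto simp: cell_def)

lemma cell_less: "0 < k \<Longrightarrow> cell k x < k * k"
  using strip_less[of k "fst x"] strip_less[of k "snd x"]
    mult_le_mono2[of "Suc (strip k (snd x))" k k]
  unfolding cell_def by (simp add: Suc_le_eq)

text \<open>The next number advances the column by one modulo \<open>k\<close> and the row by zero
  or one; the step from the last cell to the first advances both. Each coordinate then contributes
  at most \<open>2 / k\<close>.\<close>

lemma torus_dist_cells_le:
  assumes k: "0 < k"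
    and adj: "cell k y = cell k x \<or> cell k y = Suc (cell k x) \<or> cell k x = k * k - 1 \<and> cell k y = 0"
  shows "torus_dist x y \<le> 4 / real k"
proof -
  have "\<exists>d\<le>1. \<exists>e\<le>1. strip k (fst y) = (strip k (fst x) + d) mod k \<and>
                     strip k (snd y) = (strip k (snd x) + e) mod k"
    using adj
  proof (elim disjE conjE)
    assume "cell k y = cell k x"
    then have "strip k (fst y) = strip k (fst x)" "strip k (snd y) = strip k (snd x)"
      using cell_mod_div[OF k] by metis+
    then show ?thesis using strip_less[OF k] by (intro exI[of _ 0] conjI) auto
  next
    assume y: "cell k y = Suc (cell k x)"
    have "strip k (fst y) = Suc (strip k (fst x)) mod k"
      using cell_mod_div(1)[OF k] y by (metis mod_Suc_eq)
    moreover have "strip k (snd y) = strip k (snd x) \<or> strip k (snd y) = Suc (strip k (snd x))"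
      using cell_mod_div(2)[OF k] y div_Suc[of "cell k x" k] by metis
    then have "\<exists>e\<le>1. strip k (snd y) = (strip k (snd x) + e) mod k"
      using strip_less[OF k, of "snd y"] by (metis One_nat_def Suc_eq_plus1 add_0_right le_refl mod_less zero_le)
    ultimately show ?thesis by (metis Suc_eq_plus1 le_refl)
  next
    assume x: "cell k x = k * k - 1" and y: "cell k y = 0"
    have "k * k - 1 = (k - 1) + k * (k - 1)" using k by (cases k) auto
    then have "cell k x mod k = k - 1" "cell k x div k = k - 1"
      using k by (simp_all only: x mod_mult_self2 div_mult_self2) auto
    then have "strip k (fst x) = k - 1" "strip k (snd x) = k - 1"
      using cell_mod_div[OF k, of x] by auto
    moreover have "strip k (fst y) = 0" "strip k (snd y) = 0"
      using cell_mod_div[OF k, of y] unfolding y by auto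
    ultimately show ?thesis using k by (intro exI[of _ 1] conjI) auto
  qed
  then obtain d e where "d \<le> 1" "e \<le> 1" "strip k (fst y) = (strip k (fst x) + d) mod k"
    "strip k (snd y) = (strip k (snd x) + e) mod k" by blast
  then obtain z w where "z \<in> \<int>" "w \<in> \<int>" "\<bar>fst x - (fst y + z)\<bar> \<le> 2 / real k"
    "\<bar>snd x - (snd y + w)\<bar> \<le> 2 / real k" using strip_close[OF k] by meson
  then show ?thesis using torus_dist_le[of z w x y] by simp
qed

text \<open>The part of a cell in the half-open unit square: a product of intervals of known
  measure, contained in the cell, which suits a lower bound on the number of points.\<close>

definition cell_box :: "nat \<Rightarrow> nat \<Rightarrow> (real \<times> real) set" where
  "cell_box k i = {real (i mod k) / real k..<real (Suc (i mod k)) / real k} \<times>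
                  {real (i div k) / real k..<real (Suc (i div k)) / real k}"

lemma strip_eqI:
  assumes "a < k" "real a / real k \<le> x" "x < real (Suc a) / real k"
  shows "strip k x = a"
proof -
  have "\<lfloor>real k * x\<rfloor> = int a"
    using assms by (intro floor_unique) (auto simp: field_simps)
  then show ?thesis using assms(1) by (simp add: strip_def)
qed

lemma cell_if_cell_box:
  assumes "0 < k" "i < k * k" "x \<in> cell_box k i"
  shows "cell k x = i"
proof -
  have "i mod k < k" "i div k < k" using assms by (auto simp: less_mult_imp_div_less)
  then have "strip k (fst x) = i mod k" "strip k (snd x) = i div k"
    using assms(3) by (auto simp: cell_box_def intro!: strip_eqI)
  then show ?thesis by (simp add: cell_def)
qed

section \<open>Measure of a cell and its number of points\<close>

lemma emeasure_lborel_Times_Ico: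
  fixes a b c d :: real
  assumes "a \<le> b" "c \<le> d"
  shows "emeasure lborel ({a..<b} \<times> {c..<d}) = ennreal ((b - a) * (d - c))"
  unfolding lborel_prod[symmetric] using assms
  by (subst lborel.emeasure_pair_measure_Times) (auto simp: ennreal_mult)

lemma emeasure_unit_square: "emeasure lborel ({0..1} \<times> {0..1} :: (real \<times> real) set) = 1"
  unfolding lborel_prod[symmetric] by (subst lborel.emeasure_pair_measure_Times) auto

lemma sets_uniform_torus [measurable_cong]: "sets uniform_torus = sets borel"
  by (simp add: uniform_torus_def)

lemma space_uniform_torus [simp]: "space uniform_torus = UNIV"
  by (simp add: uniform_torus_def)

lemma prob_space_uniform_torus: "prob_space uniform_torus"
  unfolding uniform_torus_def by (rule prob_space_uniform_measure) (auto simp: emeasure_unit_square)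

lemma cell_box_borel [measurable]: "cell_box k i \<in> sets borel"
  unfolding cell_box_def by (intro borel_Times) auto

lemma measure_cell_box:
  assumes "0 < k" "i < k * k"
  shows "measure uniform_torus (cell_box k i) = 1 / real k ^ 2"
proof -
  have a: "i mod k < k" "i div k < k" using assms by (auto simp: less_mult_imp_div_less)
  have "cell_box k i \<subseteq> {0..1} \<times> {0..1}"
  proof -
    have "{real j / real k..<real (Suc j) / real k} \<subseteq> {0..1}" if "j < k" for j
    proof -
      have "real (Suc j) / real k \<le> 1" using that by simp
      moreover have "0 \<le> real j / real k" by simp
      ultimately show ?thesis by (meson atLeastAtMost_iff atLeastLessThan_iff less_imp_le order_trans subsetI)
    qed
    then show ?thesis unfolding cell_box_def using a by (intro Sigma_mono) auto
  qed
  then have "measure uniform_torus (cell_box k i) = measure lborel (cell_box k i)"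
    unfolding uniform_torus_def
    by (subst measure_uniform_measure) (auto simp: emeasure_unit_square measure_def Int_absorb1)
  also have "\<dots> = 1 / real k ^ 2"
    unfolding cell_box_def measure_def
    by (subst emeasure_lborel_Times_Ico)
       (auto simp: divide_right_mono diff_divide_distrib[symmetric] power2_eq_square)
  finally show ?thesis .
qed

text \<open>Markov's inequality for \<open>(1/2)\<close> to the power of the number of points in \<open>B\<close>.\<close>

lemma prob_few_points:
  assumes B [measurable]: "B \<in> sets borel" and q: "measure uniform_torus B = q"
  shows "measure (\<Pi>\<^sub>M i\<in>{..<n}. uniform_torus)
           {X \<in> space (\<Pi>\<^sub>M i\<in>{..<n}. uniform_torus). real (card {i \<in> {..<n}. X i \<in> B}) \<le> real n * q / 2}
         \<le> exp (- (real n * q / 10))"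
proof -
  interpret T: prob_space uniform_torus by (rule prob_space_uniform_torus)
  interpret P: product_prob_space "\<lambda>_. uniform_torus" "{..<n}" ..
  let ?M = "\<Pi>\<^sub>M i\<in>{..<n}. uniform_torus"
  let ?f = "\<lambda>x. 1 - indicator B x / 2 :: real"
  define u where "u = (\<lambda>X :: nat \<Rightarrow> real \<times> real. \<Prod>i\<in>{..<n}. ?f (X i))"
  \<comment> \<open>This is \<open>(1 / 2)\<close> to the power \<open>n * q / 2\<close>, the value
    of \<open>u\<close> at the threshold; few points in \<open>B\<close> means that \<open>u\<close>
    is large.\<close>
  define c :: real where "c = exp (- (real n * q / 2 * ln 2))"
  have int_f: "integrable uniform_torus ?f"
    by (intro Bochner_Integration.integrable_diff integrable_divide integrable_real_indicator)
       (auto simp: T.emeasure_finite less_top[symmetric])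
  have u_eq: "u X = (1 / 2) ^ card {i \<in> {..<n}. X i \<in> B}" for X
  proof -
    have "u X = (\<Prod>i\<in>{..<n}. if X i \<in> B then 1 / 2 else 1)"
      unfolding u_def by (intro prod.cong) auto
    also have "\<dots> = (1 / 2) ^ card ({..<n} \<inter> {i. X i \<in> B})" by (simp add: prod.If_cases)
    also have "{..<n} \<inter> {i. X i \<in> B} = {i \<in> {..<n}. X i \<in> B}" by auto
    finally show ?thesis .
  qed
  have c_le_u: "real (card {i \<in> {..<n}. X i \<in> B}) \<le> real n * q / 2 \<longleftrightarrow> c \<le> u X" for X
  proof -
    let ?m = "card {i \<in> {..<n}. X i \<in> B}"
    have "u X = exp (- ln 2) ^ ?m" unfolding u_eq by (simp add: exp_minus)
    also have "\<dots> = exp (- (real ?m * ln 2))" by (simp only: exp_of_nat_mult[symmetric]) simp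
    finally show ?thesis by (simp add: c_def)
  qed
  have "measure ?M {X \<in> space ?M. real (card {i \<in> {..<n}. X i \<in> B}) \<le> real n * q / 2} =
          measure ?M {X \<in> space ?M. c \<le> u X}"
    by (intro arg_cong[where f = "measure ?M"] Collect_cong conj_cong refl)
       (simp only: c_le_u)
  also have "\<dots> \<le> (\<integral>X. u X \<partial>?M) / c"
  proof (rule integral_Markov_inequality_measure[where A = "space ?M"])
    show "integrable ?M u" unfolding u_def by (intro P.product_integrable_prod int_f) auto
  qed (auto simp: u_eq c_def)
  also have "(\<integral>X. u X \<partial>?M) = (1 - q / 2) ^ n"
  proof -
    have "(\<integral>X. u X \<partial>?M) = (\<Prod>i\<in>{..<n}. \<integral>x. ?f x \<partial>uniform_torus)"
      unfolding u_def by (intro P.product_integral_prod int_f) auto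
    also have "(\<integral>x. ?f x \<partial>uniform_torus) = 1 - q / 2"
      using q T.prob_space by (subst Bochner_Integration.integral_diff) (auto simp: T.emeasure_finite less_top[symmetric])
    finally show ?thesis by simp
  qed
  also have "(1 - q / 2) ^ n \<le> exp (- (real n * q / 2))"
  proof -
    have "0 \<le> q" "q \<le> 1" using q T.prob_le_1[of B] by auto
    then show ?thesis by (intro power_one_minus_le_exp) auto
  qed
  then have "(1 - q / 2) ^ n / c \<le> exp (- (real n * q / 2)) / c"
    by (intro divide_right_mono) (auto simp: c_def)
  also have "\<dots> = exp (real n * q / 2 * ln 2 - real n * q / 2)"
    by (simp add: c_def flip: exp_diff)
  also have "\<dots> \<le> exp (- (real n * q / 10))"
  proof -
    \<comment> \<open>The exponent is at most \<open>- (1 - 25 / 36) / 2 = - 11 / 72\<close> times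
      \<open>n * q\<close>, and \<open>11 / 72 > 1 / 10\<close>.\<close>
    have "0 \<le> real n * q / 2" using q by auto
    then have "real n * q / 2 * ln 2 \<le> real n * q / 2 * (25 / 36)"
      using ln2_le_25_over_36 by (rule mult_left_mono[rotated])
    then show ?thesis using \<open>0 \<le> real n * q / 2\<close> by (subst exp_le_cancel_iff) linarith
  qed
  finally show ?thesis .
qed

section \<open>The random graph\<close>

lemma mem_geometric_graph:
  "e \<in> geometric_graph n r X \<longleftrightarrow>
     (\<exists>i<n. \<exists>j<n. i \<noteq> j \<and> e = {i, j} \<and> torus_dist (X i) (X j) \<le> r)"
  unfolding geometric_graph_def by blast

lemma geometric_graph_subset: "geometric_graph n r X \<subseteq> vertex_pairs n"
  by (auto simp: mem_geometric_graph vertex_pairs_def)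

lemma sets_few_points:
  fixes n :: nat
  assumes [measurable]: "B \<in> sets borel"
  shows "{X \<in> space (\<Pi>\<^sub>M i\<in>{..<n}. uniform_torus). real (card {i \<in> {..<n}. X i \<in> B}) \<le> t}
           \<in> sets (\<Pi>\<^sub>M i\<in>{..<n}. uniform_torus)"
proof -
  have "real (card {i \<in> {..<n}. X i \<in> B}) = (\<Sum>i\<in>{..<n}. indicator B (X i))" for X
    by (simp add: indicator_def sum_of_bool_eq Int_def)
  then show ?thesis by simp
qed

text \<open>The geometric graph takes finitely many values, each on a measurable set of positions;
  for a fixed value the condition concerns the discrete factor alone.\<close>

lemma pred_hamiltonian:
  "Measurable.pred (sample_space n p)
     (\<lambda>(X, F). hamiltonian {..<n} (geometric_graph n r X \<inter> F))"
proof -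
  let ?M = "\<Pi>\<^sub>M i\<in>{..<n}. uniform_torus"
  have edge [measurable]: "Measurable.pred ?M (\<lambda>X. e \<in> geometric_graph n r X)" for e
    unfolding mem_geometric_graph by measurable
  have graph: "Measurable.pred ?M (\<lambda>X. geometric_graph n r X = G)" if "G \<subseteq> vertex_pairs n" for G
  proof -
    have "geometric_graph n r X = G \<longleftrightarrow>
            (\<forall>e\<in>vertex_pairs n. e \<in> geometric_graph n r X \<longleftrightarrow> e \<in> G)" for X
      using geometric_graph_subset[of n r X] that by blast
    then show ?thesis using finite_vertex_pairs[of n] by simp
  qed
  have "(\<lambda>(X, F). hamiltonian {..<n} (geometric_graph n r X \<inter> F)) =
          (\<lambda>\<omega>. \<exists>G\<in>Pow (vertex_pairs n). geometric_graph n r (fst \<omega>) = G \<and> hamiltonian {..<n} (G \<inter> snd \<omega>))"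
    using geometric_graph_subset by (auto simp: fun_eq_iff)
  moreover have "Measurable.pred (sample_space n p)
      (\<lambda>\<omega>. \<exists>G\<in>Pow (vertex_pairs n). geometric_graph n r (fst \<omega>) = G \<and> hamiltonian {..<n} (G \<inter> snd \<omega>))"
    unfolding sample_space_def
  proof (intro pred_intros_finite pred_intros_logic)
    show "finite (Pow (vertex_pairs n))" by (simp add: finite_vertex_pairs)
    fix G assume "G \<in> Pow (vertex_pairs n)"
    then show "Measurable.pred (?M \<Otimes>\<^sub>M measure_pmf (erdos_renyi n p))
        (\<lambda>\<omega>. geometric_graph n r (fst \<omega>) = G)"
      using measurable_compose[OF measurable_fst graph] by simp
    show "Measurable.pred (?M \<Otimes>\<^sub>M measure_pmf (erdos_renyi n p))
        (\<lambda>\<omega>. hamiltonian {..<n} (G \<inter> snd \<omega>))"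
      by (rule measurable_compose[OF measurable_snd]) simp
  qed
  ultimately show ?thesis by simp
qed

text \<open>Once the positions are fixed, geometry only has to supply the pairs inside a cell,
  between consecutive cells, and between the last and the first one. \<open>k >= 2\<close> makes at
  least four cells.\<close>

lemma prob_hamiltonian_given_positions:
  assumes n: "2 \<le> n" and k: "2 \<le> k" "4 / real k \<le> r" and p: "0 \<le> p" "p \<le> 1"
    and dense: "\<And>i. i < k * k \<Longrightarrow> 1000 * ln (real n) \<le> p * real (card {v \<in> {..<n}. cell k (X v) = i})"
  shows "1 - 4 / real n \<le>
    measure_pmf.prob (erdos_renyi n p) {F. hamiltonian {..<n} (geometric_graph n r X \<inter> F)}"
proof -
  let ?V = "\<lambda>i. {v \<in> {..<n}. cell k (X v) = i}"
  have k0: "0 < k" using k by simp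
  have kk: "4 \<le> k * k" using mult_le_mono[OF k(1) k(1)] by simp
  interpret cell_partition n "k * k" ?V p
  proof
    show "(\<Union>i<k * k. ?V i) = {..<n}" using k0 by (auto intro: cell_less)
  qed (use n p dense kk in auto)
  have near: "{v, w} \<in> geometric_graph n r X"
    if "v < n" "w < n" "v \<noteq> w"
      "cell k (X w) = cell k (X v) \<or> cell k (X w) = Suc (cell k (X v)) \<or>
       cell k (X v) = k * k - 1 \<and> cell k (X w) = 0" for v w
  proof -
    have "torus_dist (X v) (X w) \<le> r"
      using torus_dist_cells_le[OF k0 that(4)] k(2) by (rule order_trans)
    then show ?thesis using that unfolding mem_geometric_graph by blast
  qed
  have "inner_pairs \<inter> vertex_pairs n \<subseteq> geometric_graph n r X"
  proof
    fix e assume e: "e \<in> inner_pairs \<inter> vertex_pairs n"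
    then obtain v w where vw: "e = {v, w}" "v \<noteq> w" "v < n" "w < n"
      by (auto simp: vertex_pairs_def card_2_iff)
    from e consider i where "{v, w} \<subseteq> ?V i" | i where "{v, w} \<in> cross (?V i) (?V (Suc i))"
      unfolding inner_pairs_def vw by blast
    then show "e \<in> geometric_graph n r X"
    proof cases
      case 1
      then show ?thesis using near[of v w] vw by auto
    next
      case 2
      then have "cell k (X w) = Suc (cell k (X v)) \<or> cell k (X v) = Suc (cell k (X w))"
        by (auto simp: mem_cross doubleton_eq_iff)
      then show ?thesis using near[of v w] near[of w v] vw by (auto simp: insert_commute)
    qed
  qed
  moreover have "cross (?V 0) (?V (k * k - 1)) \<subseteq> geometric_graph n r X"
  proof
    fix e assume "e \<in> cross (?V 0) (?V (k * k - 1))"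
    then obtain v w where "v \<in> ?V 0" "w \<in> ?V (k * k - 1)" "e = {w, v}"
      unfolding mem_cross by (auto simp: insert_commute)
    then show "e \<in> geometric_graph n r X" using near[of w v] kk by (cases "w = v") auto
  qed
  ultimately show ?thesis
    using prob_hamiltonian[of "geometric_graph n r X"]
    by (simp add: erdos_renyi_def random_subset_def)
qed

lemma prob_hamiltonian_intersection:
  assumes n: "2 \<le> n" and r: "0 < r" "r \<le> 1" and p: "0 \<le> p" "p \<le> 1"
    and q: "200000 * ln (real n) / real n \<le> pi * r\<^sup>2 * p"
  shows "1 - 5 / real n \<le>
    \<P>((X, F) in sample_space n p. hamiltonian {..<n} (geometric_graph n r X \<inter> F))"
proof -
  let ?M = "\<Pi>\<^sub>M i\<in>{..<n}. uniform_torus"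
  define k where "k = nat \<lceil>4 / r\<rceil>"
  define t where "t = real n * (1 / real k ^ 2)"
  define few where "few = (\<lambda>i. {X \<in> space ?M. real (card {v \<in> {..<n}. X v \<in> cell_box k i}) \<le> t / 2})"
  define G where "G = space ?M - (\<Union>i<k * k. few i)"
  interpret T: prob_space uniform_torus by (rule prob_space_uniform_torus)
  interpret M: prob_space ?M by (intro prob_space_PiM T.prob_space_axioms)
  have "4 \<le> 4 / r" using r by (simp add: field_simps)
  then have k_lower: "4 \<le> real k" "4 / r \<le> real k" "real k \<le> 4 / r + 1" unfolding k_def by linarith+
  then have k0: "2 \<le> k" "0 < k" "4 / real k \<le> r" using r by (auto simp: field_simps)
  have lnn: "0 < ln (real n)" using n by simp
  have t1: "1000 * ln (real n) \<le> p * (t / 2)"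
  proof -
    \<comment> \<open>From \<open>k <= 4 / r + 1\<close> and \<open>r <= 1\<close>. Squaring gives
      the 25, and \<open>pi < 4\<close> the remaining factor of 100.\<close>
    have "real k * r \<le> 5" using k_lower(3) r by (simp add: field_simps)
    then have "(real k * r) ^ 2 \<le> 5 ^ 2" using r by (intro power_mono) auto
    then have "real k ^ 2 * r ^ 2 \<le> 25" by (simp add: power_mult_distrib)
    then have "r ^ 2 \<le> 25 * (1 / real k ^ 2)" using k0 by (simp add: field_simps)
    then have "pi * r ^ 2 \<le> 4 * (25 * (1 / real k ^ 2))"
      using pi_less_4 by (intro mult_mono) auto
    then have "pi * r\<^sup>2 * p \<le> 4 * (25 * (1 / real k ^ 2)) * p"
      using p by (intro mult_right_mono) auto
    then have "200000 * ln (real n) / real n \<le> 100 * (1 / real k ^ 2) * p" using q by simp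
    then have "real n * (200000 * ln (real n) / real n) \<le> real n * (100 * (1 / real k ^ 2) * p)"
      by (intro mult_left_mono) auto
    then have "200000 * ln (real n) \<le> real n * (100 * (1 / real k ^ 2) * p)"
      using n by simp
    moreover have "real n * (100 * (1 / real k ^ 2) * p) = 200 * (p * (t / 2))" by (simp add: t_def)
    ultimately show ?thesis by linarith
  qed
  \<comment> \<open>As \<open>p <= 1\<close>, the edge density already forces the mean number
    \<open>t\<close> of points per cell to be of order \<open>ln n\<close>, enough for the tail
    bound.\<close>
  also have "\<dots> \<le> 1 * (t / 2)" using p by (intro mult_right_mono) (auto simp: t_def)
  finally have t2: "2000 * ln (real n) \<le> t" by simp
  have few_sets [measurable]: "few i \<in> sets ?M" for i
    unfolding few_def by (rule sets_few_points) simp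
  have G [measurable]: "G \<in> sets ?M" unfolding G_def by measurable
  have few_le: "M.prob (few i) \<le> 1 / real n ^ 2" if "i < k * k" for i
  proof -
    have "M.prob (few i) \<le> exp (- (t / 10))"
      using prob_few_points[OF cell_box_borel measure_cell_box[OF k0(2) that], of n]
      by (simp add: few_def t_def)
    also have "\<dots> \<le> exp (- (real 2 * ln (real n)))" using t2 lnn by simp
    also have "\<dots> = 1 / real n ^ 2" using n by (intro exp_minus_mult_ln) simp
    finally show ?thesis .
  qed
  have "real (k * k) \<le> real n"
  proof -
    have "ln 2 \<le> ln (real n)" using n by simp
    then have "1 \<le> t" using t2 ln2_ge_two_thirds by linarith
    then show ?thesis using k0 by (simp add: t_def field_simps power2_eq_square)
  qed
  have "M.prob (\<Union>i<k * k. few i) \<le> (\<Sum>i<k * k. M.prob (few i))"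
    by (rule measure_UNION_le) auto
  also have "\<dots> \<le> (\<Sum>i<k * k. 1 / real n ^ 2)" using few_le by (intro sum_mono) auto
  also have "\<dots> = real (k * k) * (1 / real n ^ 2)" by simp
  also have "\<dots> \<le> real n * (1 / real n ^ 2)"
    using \<open>real (k * k) \<le> real n\<close> by (rule mult_right_mono) simp
  also have "\<dots> = 1 / real n" using n by (simp add: power2_eq_square)
  finally have probG: "1 - 1 / real n \<le> M.prob G"
    unfolding G_def by (subst M.prob_compl) auto
  let ?H = "{\<omega> \<in> space (sample_space n p).
    case \<omega> of (X, F) \<Rightarrow> hamiltonian {..<n} (geometric_graph n r X \<inter> F)}"
  have H: "?H \<in> sets (sample_space n p)" using pred_hamiltonian by (simp add: pred_def)
  have section_ge: "ennreal (1 - 4 / real n) * indicator G X \<le>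
      emeasure (measure_pmf (erdos_renyi n p)) (Pair X -` ?H)" if X: "X \<in> space ?M" for X
  proof (cases "X \<in> G")
    case True
    have "1 - 4 / real n \<le>
      measure_pmf.prob (erdos_renyi n p) {F. hamiltonian {..<n} (geometric_graph n r X \<inter> F)}"
    proof (rule prob_hamiltonian_given_positions[OF n k0(1) k0(3) p])
      fix i assume i: "i < k * k"
      have "t / 2 \<le> real (card {v \<in> {..<n}. X v \<in> cell_box k i})"
        using True i unfolding G_def few_def by force
      also have "\<dots> \<le> real (card {v \<in> {..<n}. cell k (X v) = i})"
        using k0(2) i by (intro of_nat_mono card_mono) (auto intro: cell_if_cell_box)
      finally have "p * (t / 2) \<le> p * real (card {v \<in> {..<n}. cell k (X v) = i})"
        using p by (intro mult_left_mono) auto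
      then show "1000 * ln (real n) \<le> p * real (card {v \<in> {..<n}. cell k (X v) = i})"
        using t1 by linarith
    qed
    moreover have "Pair X -` ?H = {F. hamiltonian {..<n} (geometric_graph n r X \<inter> F)}"
      using X by (auto simp: sample_space_def space_pair_measure)
    ultimately show ?thesis
      using True by (simp add: measure_pmf.emeasure_eq_measure ennreal_leI)
  qed simp
  interpret S: pair_prob_space ?M "measure_pmf (erdos_renyi n p)" ..
  have "ennreal (1 - 4 / real n) * emeasure ?M G =
          (\<integral>\<^sup>+X. ennreal (1 - 4 / real n) * indicator G X \<partial>?M)"
    by (rule nn_integral_cmult_indicator [symmetric]) (rule G)
  also have "\<dots> \<le> (\<integral>\<^sup>+X. emeasure (measure_pmf (erdos_renyi n p)) (Pair X -` ?H) \<partial>?M)"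
    by (intro nn_integral_mono section_ge)
  also have "\<dots> = emeasure (sample_space n p) ?H"
    using H unfolding sample_space_def
    by (intro measure_pmf.emeasure_pair_measure_alt [symmetric])
  finally have *: "ennreal (1 - 4 / real n) * emeasure ?M G \<le> emeasure (sample_space n p) ?H" .
  have "prob_space (sample_space n p)" unfolding sample_space_def by unfold_locales
  then interpret P: prob_space "sample_space n p" .
  have "{(X, F). (X, F) \<in> space (sample_space n p) \<and>
          hamiltonian {..<n} (geometric_graph n r X \<inter> F)} = ?H" by auto
  moreover have "1 - 5 / real n \<le> P.prob ?H"
  \<comment> \<open>\<open>ennreal\<close> truncates negative numbers, so the product bound is read
    back for \<open>n >= 4\<close> only; for smaller \<open>n\<close> the claimed bound is
    negative.\<close>
  proof (cases "4 \<le> real n")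
    case True
    then have nn: "0 \<le> 1 - 4 / real n" by simp
    have "(1 - 4 / real n) * (1 - 1 / real n) \<le> (1 - 4 / real n) * M.prob G"
      using probG nn by (rule mult_left_mono)
    also have "\<dots> \<le> P.prob ?H"
      using * nn by (simp add: M.emeasure_eq_measure P.emeasure_eq_measure flip: ennreal_mult)
    finally have "(1 - 4 / real n) * (1 - 1 / real n) \<le> P.prob ?H" .
    moreover have "1 - 5 * x \<le> (1 - 4 * x) * (1 - x)" for x :: real
      by (simp add: algebra_simps)
    from this[of "1 / real n"] have "1 - 5 / real n \<le> (1 - 4 / real n) * (1 - 1 / real n)" by simp
    ultimately show ?thesis by linarith
  next
    case False
    then have "1 - 5 / real n \<le> 0" using n by (simp add: field_simps)
    also have "0 \<le> P.prob ?H" by simp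
    finally show ?thesis .
  qed
  ultimately show ?thesis by (simp only:)
qed

theorem theorem3:
  "\<exists>r0>0. \<exists>K>0. \<forall>(r :: nat \<Rightarrow> real) (p :: nat \<Rightarrow> real).
     (\<forall>n. 0 \<le> r n \<and> r n \<le> r0) \<longrightarrow>
     (\<forall>n. 0 \<le> p n \<and> p n \<le> 1) \<longrightarrow>
     (\<forall>\<^sub>F n in sequentially. pi * (r n)\<^sup>2 * p n \<ge> K * ln (real n) / real n) \<longrightarrow>
     (\<lambda>n. \<P>((X, F) in sample_space n (p n).
            hamiltonian {..<n} (geometric_graph n (r n) X \<inter> F))) \<longlonglongrightarrow> 1"
proof (rule exI[of _ 1], rule conjI[OF zero_less_one], rule exI[of _ 200000], intro conjI allI impI)
  fix r p :: "nat \<Rightarrow> real"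
  assume r: "\<forall>n. 0 \<le> r n \<and> r n \<le> 1" and p: "\<forall>n. 0 \<le> p n \<and> p n \<le> 1"
    and q: "\<forall>\<^sub>F n in sequentially. pi * (r n)\<^sup>2 * p n \<ge> 200000 * ln (real n) / real n"
  let ?P = "\<lambda>n. \<P>((X, F) in sample_space n (p n).
              hamiltonian {..<n} (geometric_graph n (r n) X \<inter> F))"
  show "?P \<longlonglongrightarrow> 1"
  proof (rule tendsto_sandwich[where h = "\<lambda>_. 1"])
    show "\<forall>\<^sub>F n in sequentially. 1 - 5 / real n \<le> ?P n"
      using q eventually_ge_at_top[of 2]
    proof eventually_elim
      case (elim n)
      \<comment> \<open>For \<open>n >= 2\<close> the threshold is positive, which rules out radius
        0, where \<open>4 / r\<close> would make no sense.\<close>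
      have "0 < 200000 * ln (real n) / real n" using elim by simp
      moreover have "200000 * ln (real n) / real n \<le> 0" if "r n = 0" using elim(1) that by simp
      ultimately have "r n \<noteq> 0" by linarith
      then have "0 < r n" using r by (simp add: less_le)
      then show ?case using elim r p by (intro prob_hamiltonian_intersection) auto
    qed
    show "\<forall>\<^sub>F n in sequentially. ?P n \<le> 1"
    proof (intro always_eventually allI)
      fix n :: nat
      interpret T: prob_space uniform_torus by (rule prob_space_uniform_torus)
      interpret M: prob_space "\<Pi>\<^sub>M i\<in>{..<n}. uniform_torus"
        by (intro prob_space_PiM T.prob_space_axioms)
      interpret S: pair_prob_space "\<Pi>\<^sub>M i\<in>{..<n}. uniform_torus" "measure_pmf (erdos_renyi n (p n))" ..
      show "?P n \<le> 1" unfolding sample_space_def by (rule S.prob_le_1)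
    qed
    show "(\<lambda>n. 1 - 5 / real n) \<longlonglongrightarrow> 1"
      using tendsto_diff[OF tendsto_const lim_const_over_n[of "5 :: real"], of 1] by simp
  qed simp
qed simp

end
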